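(* Let $\varphi:\mathbb N\to\mathbb R^+$ satisfy $\sum_{k\ge0}\varphi(k)=1$ and $\sum_{k\ge0}k\varphi(k)<\infty$, and put $\phi(x):=\sum_{k=x}^\infty\varphi(k)$. For $b\in\mathbb N$, $a\in\mathbb Z$ let $$f(b,a):=\mathbf 1_{b=0}\,\varphi(0)+\mathbf 1_{b\ne0}\left[\varphi(b)\left(1-\frac{a^+}{b}\right)+a^+\sum_{k=b}^\infty\frac{\varphi(k)}{k(k+1)}\right].$$ Then for all $n\ge0$ and all $\Lambda_n\in\mathcal F_n$, $$\lim_{p\to\infty}\frac{\mathbb E[\mathbf 1_{\Lambda_n}\varphi(S_{d_p})]}{\mathbb E[\varphi(S_{d_p})]}=\lim_{p\to\infty}\frac{\mathbb E[\mathbf 1_{\Lambda_n}f(S_p,X_p)]}{\mathbb E[f(S_p,X_p)]}=\lim_{p\to\infty}\frac{\mathbb E[\mathbf 1_{\Lambda_n}\varphi(S_p)]}{\mathbb E[\varphi(S_p)]}=\mathbb E[\mathbf 1_{\Lambda_n}M_n^\varphi],$$ where $M_n^\varphi:=\varphi(S_n)(S_n-X_n)+\phi(S_n)$.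
   Context: $\mathbb N=\{0,1,2,\dots\}$. $\Omega$ is the set of paths $\omega:\mathbb N\to\mathbb Z$ with $|\omega(n+1)-\omega(n)|=1$; $X=(X_n)_{n\ge0}$ is the coordinate process, $\mathcal F_n=\sigma(X_0,\dots,X_n)$. Under $\mathbb P=\mathbb P_0$ (expectation $\mathbb E$), $X$ is the simple symmetric random walk on $\mathbb Z$ started from $0$. $S_n:=\max_{0\le k\le n}X_k$; $x^+:=\max(x,0)$; $d_p:=\inf\{k\ge p:X_k=0\}$. *)

theory Defs
  imports "HOL-Probability.Probability"
begin

definition paths :: "(nat \<Rightarrow> int) set" where
  "paths = {\<omega>. \<forall>n. \<bar>\<omega> (Suc n) - \<omega> n\<bar> = 1}"

definition path_algebra :: "(nat \<Rightarrow> int) measure" where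
  "path_algebra = sigma paths {{\<omega> \<in> paths. \<omega> k \<in> A} | k A. True}"

definition \<F> :: "nat \<Rightarrow> (nat \<Rightarrow> int) set set" where
  "\<F> n = sigma_sets paths {{\<omega> \<in> paths. \<omega> k \<in> A} | k A. k \<le> n}"

definition coin_tosses :: "(nat \<Rightarrow> bool) measure" where
  "coin_tosses = PiM UNIV (\<lambda>_. measure_pmf (bernoulli_pmf (1/2)))"

definition walk_path :: "(nat \<Rightarrow> bool) \<Rightarrow> nat \<Rightarrow> int" where
  "walk_path \<epsilon> n = (\<Sum>i<n. if \<epsilon> i then 1 else -1)"

text \<open>The law on the path space of the simple symmetric random walk started from 0.\<close>

definition srw :: "(nat \<Rightarrow> int) measure" where
  "srw = distr coin_tosses path_algebra walk_path"

definition running_max :: "nat \<Rightarrow> (nat \<Rightarrow> int) \<Rightarrow> int" where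
  "running_max n \<omega> = Max (\<omega> ` {..n})"

text \<open>A path which does not visit 0 at or after time \<open>p\<close> gets the junk value
  \<^term>\<open>Inf {} :: nat\<close>; under \<^const>\<open>srw\<close> such paths form a null set by recurrence.\<close>

definition next_zero :: "nat \<Rightarrow> (nat \<Rightarrow> int) \<Rightarrow> nat" where
  "next_zero p \<omega> = Inf {k. p \<le> k \<and> \<omega> k = 0}"

definition tail :: "(nat \<Rightarrow> real) \<Rightarrow> nat \<Rightarrow> real" where
  "tail \<phi> x = (\<Sum>j. \<phi> (x + j))"

text \<open>In the series the summation index \<open>k \<ge> b\<close> is written as \<open>k = b + j\<close>.\<close>

definition f_pen :: "(nat \<Rightarrow> real) \<Rightarrow> nat \<Rightarrow> int \<Rightarrow> real" where
  "f_pen \<phi> b a =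
     (if b = 0 then \<phi> 0
      else \<phi> b * (1 - of_int (max a 0) / of_nat b)
           + of_int (max a 0) *
             (\<Sum>j. \<phi> (b + j) / (of_nat (b + j) * (of_nat (b + j) + 1))))"

text \<open>Paths may start anywhere, so the running maximum is integer-valued; it is nonnegative
  \<^const>\<open>srw\<close>-almost surely because the walk starts from 0, so that \<^const>\<open>nat\<close> below only
  changes the type of the argument.\<close>

definition M_pen :: "(nat \<Rightarrow> real) \<Rightarrow> nat \<Rightarrow> (nat \<Rightarrow> int) \<Rightarrow> real" where
  "M_pen \<phi> n \<omega> =
     \<phi> (nat (running_max n \<omega>)) * of_int (running_max n \<omega> - \<omega> n)
     + tail \<phi> (nat (running_max n \<omega>))"

lemma space_path_algebra [simp]: "space path_algebra = paths"
  unfolding path_algebra_def by (rule space_measure_of) auto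

lemma sets_path_algebra:
  "sets path_algebra = sigma_sets paths {{\<omega> \<in> paths. \<omega> k \<in> A} | k A. True}"
  unfolding path_algebra_def by (rule sets_measure_of) auto

lemma filtration_subset: "\<F> n \<subseteq> sets path_algebra"
  unfolding sets_path_algebra \<F>_def by (rule sigma_sets_mono') auto

lemma prob_space_coin_tosses: "prob_space coin_tosses"
  unfolding coin_tosses_def by (intro prob_space_PiM measure_pmf.prob_space_axioms)

lemma walk_path_in_paths: "walk_path \<epsilon> \<in> paths"
  by (auto simp: paths_def walk_path_def)

lemma walk_path_measurable: "walk_path \<in> measurable coin_tosses path_algebra"
  unfolding path_algebra_def
proof (rule measurable_measure_of)
  fix B assume "B \<in> {{\<omega> \<in> paths. \<omega> k \<in> A} | k A. True}"
  then obtain k A where B: "B = {\<omega> \<in> paths. \<omega> k \<in> A}" by auto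
  have *: "(\<lambda>\<epsilon>. walk_path \<epsilon> k) \<in> measurable coin_tosses (count_space UNIV)"
  proof (induction k)
    case (Suc k)
    note [measurable] = Suc
    have [measurable]: "(\<lambda>\<epsilon>. \<epsilon> k) \<in> measurable coin_tosses (count_space UNIV)"
      unfolding coin_tosses_def by measurable
    have "(\<lambda>\<epsilon>. walk_path \<epsilon> (Suc k))
        = (\<lambda>\<epsilon>. if \<epsilon> k then walk_path \<epsilon> k + 1 else walk_path \<epsilon> k - 1)"
      by (auto simp: walk_path_def)
    also have "\<dots> \<in> measurable coin_tosses (count_space UNIV)"
      by measurable
    finally show ?case .
  qed (simp add: walk_path_def)
  have "walk_path -` B \<inter> space coin_tosses
      = (\<lambda>\<epsilon>. walk_path \<epsilon> k) -` A \<inter> space coin_tosses"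
    unfolding B using walk_path_in_paths by auto
  with measurable_sets[OF *, of A] show "walk_path -` B \<inter> space coin_tosses \<in> sets coin_tosses"
    by simp
qed (auto simp: walk_path_in_paths)

lemma prob_space_srw: "prob_space srw"
  unfolding srw_def
  by (rule prob_space.prob_space_distr[OF prob_space_coin_tosses walk_path_measurable])

lemma space_srw [simp]: "space srw = paths"
  by (simp add: srw_def)

lemma sets_srw: "sets srw = sets path_algebra"
  by (simp add: srw_def)

lemma coordinate_measurable: "(\<lambda>\<omega>. \<omega> k) \<in> measurable srw (count_space UNIV)"
proof (rule measurableI)
  fix A :: "int set"
  have "(\<lambda>\<omega>. \<omega> k) -` A \<inter> space srw = {\<omega> \<in> paths. \<omega> k \<in> A}" by auto
  also have "\<dots> \<in> sets srw" unfolding sets_srw sets_path_algebra by auto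
  finally show "(\<lambda>\<omega>. \<omega> k) -` A \<inter> space srw \<in> sets srw" .
qed auto

lemma srw_cylinder:
  assumes "\<And>k. k < m \<Longrightarrow> e k \<in> {-1, 1}"
  shows "measure srw {\<omega> \<in> paths. \<omega> 0 = 0 \<and> (\<forall>k<m. \<omega> (Suc k) - \<omega> k = e k)} = (1/2) ^ m"
proof -
  let ?B = "{\<omega> \<in> paths. \<omega> 0 = 0 \<and> (\<forall>k<m. \<omega> (Suc k) - \<omega> k = e k)}"
  note [measurable] = coordinate_measurable
  interpret product_prob_space "\<lambda>_::nat. measure_pmf (bernoulli_pmf (1/2))" UNIV
    by unfold_locales
  have [measurable]: "(\<lambda>\<omega>. \<omega> (Suc k) - \<omega> k) \<in> measurable srw (count_space UNIV)" for k
  proof (rule measurable_compose_countable[where g = "\<lambda>\<omega>. \<omega> k" and f = "\<lambda>i \<omega>. \<omega> (Suc k) - i"])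
    show "(\<lambda>\<omega>. \<omega> (Suc k) - i) \<in> measurable srw (count_space UNIV)" for i
      by (rule measurable_compose[OF coordinate_measurable]) simp
  qed (rule coordinate_measurable)
  have "{\<omega> \<in> space srw. \<omega> 0 = 0 \<and> (\<forall>k<m. \<omega> (Suc k) - \<omega> k = e k)} \<in> sets srw"
    by measurable
  then have B: "?B \<in> sets path_algebra" by (simp add: sets_srw)
  have step: "walk_path \<epsilon> (Suc k) - walk_path \<epsilon> k = e k \<longleftrightarrow> (\<epsilon> k \<longleftrightarrow> e k = 1)"
    if "k < m" for \<epsilon> k
    using assms[OF that] by (auto simp: walk_path_def)
  have "walk_path \<epsilon> 0 = 0" for \<epsilon>
    by (simp add: walk_path_def)
  then have "walk_path \<epsilon> \<in> ?B \<longleftrightarrow> (\<forall>k<m. \<epsilon> k \<longleftrightarrow> e k = 1)" for \<epsilon>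
    by (simp add: walk_path_in_paths step)
  moreover have "space coin_tosses = UNIV"
    by (simp add: coin_tosses_def space_PiM)
  ultimately have "walk_path -` ?B \<inter> space coin_tosses = {\<epsilon>. \<forall>k<m. \<epsilon> k \<longleftrightarrow> e k = 1}"
    by (simp only: vimage_def Int_UNIV_right mem_Collect_eq)
  also have "\<dots> = prod_emb UNIV (\<lambda>_. measure_pmf (bernoulli_pmf (1/2))) {..<m} (\<Pi>\<^sub>E k\<in>{..<m}. {e k = 1})"
    by (simp add: set_eq_iff prod_emb_iff restrict_PiE_iff Pi_iff Ball_def)
  finally have "measure srw ?B = measure coin_tosses
      (prod_emb UNIV (\<lambda>_. measure_pmf (bernoulli_pmf (1/2))) {..<m} (\<Pi>\<^sub>E k\<in>{..<m}. {e k = 1}))"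
    unfolding srw_def measure_distr[OF walk_path_measurable B] by (rule arg_cong)
  also have "\<dots> = (\<Prod>k<m. measure (measure_pmf (bernoulli_pmf (1/2))) {e k = 1})"
    unfolding coin_tosses_def by (rule measure_PiM_emb) simp_all
  also have "\<dots> = (\<Prod>k<m. 1/2)"
    by (intro prod.cong refl) (simp add: measure_pmf_single)
  finally show ?thesis by simp
qed

end

theory Submission
  imports Defs
begin

text \<open>Write \<open>c\<^sub>p\<close> for the probability that \<open>S\<^sub>p = 0\<close>. Since \<open>P(S\<^sub>p = b) \<le> c\<^sub>p\<close>, with ratio tending
  to 1 for each fixed \<open>b\<close>, the Markov property at time \<open>n\<close> and dominated convergence give
  \<open>E[1\<^sub>\<Lambda> \<phi>(S\<^sub>p)] / c\<^sub>p \<longlonglongrightarrow> E[1\<^sub>\<Lambda> M\<^sub>n]\<close>. Both \<open>\<phi>(S\<^sub>d)\<close>, where \<open>d\<close> is the next zero after \<open>p\<close>,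
  and \<open>f(S\<^sub>p, X\<^sub>p)\<close> coincide with \<open>\<phi>(S\<^sub>p)\<close> when \<open>X\<^sub>p \<le> 0\<close>, and otherwise all three lie between 0 and
  the tail sum of \<open>\<phi>\<close> from \<open>S\<^sub>p\<close> on. The tail sums are summable because \<open>\<phi>\<close> has a first moment, and
  \<open>P(S\<^sub>p = b, X\<^sub>p > 0) = o(c\<^sub>p)\<close>, so the replacement costs only \<open>o(c\<^sub>p)\<close> and neither the ruin
  probabilities nor the identity \<open>f(S\<^sub>p, X\<^sub>p) = E[\<phi>(S\<^sub>d) | F\<^sub>p]\<close> is needed.\<close>

subsection \<open>The law of the maximum\<close>

text \<open>By the reflection principle, \<open>P(S\<^sub>p = b) = P(X\<^sub>p = b) + P(X\<^sub>p = b + 1)\<close>, where parity makes one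
  of the two terms vanish.\<close>

definition max_prob :: "nat \<Rightarrow> nat \<Rightarrow> real" where
  "max_prob p b = (p choose ((p + b + 1) div 2)) / 2 ^ p"

lemma max_prob_nonneg [simp]: "0 \<le> max_prob p b"
  by (simp add: max_prob_def)

lemma max_prob_0_pos [simp]: "0 < max_prob p 0"
  by (simp add: max_prob_def)

lemma max_prob_0: "max_prob 0 b = (if b = 0 then 1 else 0)"
  by (auto simp: max_prob_def binomial_eq_0_iff)

lemma max_prob_eq_0: "p < b \<Longrightarrow> max_prob p b = 0"
  by (simp add: max_prob_def binomial_eq_0_iff)

lemma max_prob_diag [simp]: "max_prob p p = 1 / 2 ^ p"
proof -
  have "(p + p + 1) div 2 = p" by linarith
  then show ?thesis by (simp add: max_prob_def)
qed

text \<open>Pascal's rule produces the coefficients at \<open>p div 2\<close> and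
  \<open>Suc (p div 2)\<close>; symmetry moves the first to \<open>(p + 1) div 2\<close>. In terms
  of the walk: the longer walk has maximum 0 exactly when its first step goes down and the rest has
  maximum 0 or 1.\<close>

lemma max_prob_Suc_0: "max_prob (Suc p) 0 = (max_prob p 0 + max_prob p 1) / 2"
proof -
  have "p choose (p div 2) = p choose ((p + 1) div 2)"
    by (subst binomial_symmetric) (auto intro!: arg_cong[where f = "binomial p"])
  then show ?thesis
    by (simp add: max_prob_def add_divide_distrib)
qed

lemma max_prob_Suc_Suc: "max_prob (Suc p) (Suc b) = (max_prob p b + max_prob p (Suc (Suc b))) / 2"
  by (simp add: max_prob_def add_divide_distrib)

text \<open>The recursion in \<open>p\<close> averages values two apart, which keeps a decreasing
  sequence decreasing. At \<open>b = 0\<close> the claim reduces to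
  \<open>max_prob p 2 \<le> max_prob p 1\<close>.\<close>

lemma max_prob_Suc_le: "max_prob p (Suc b) \<le> max_prob p b"
proof (induction p arbitrary: b)
  case (Suc p)
  show ?case
    using Suc.IH[of b] Suc.IH[of "Suc b"] Suc.IH[of "Suc (Suc b)"] Suc.IH[of "b - 1"]
    by (cases b) (simp_all add: max_prob_Suc_Suc max_prob_Suc_0)
qed (simp add: max_prob_0)

lemma max_prob_le: "max_prob p b \<le> max_prob p 0"
  by (induction b) (auto intro: order_trans[OF max_prob_Suc_le])

text \<open>For \<open>p = 2 * m\<close> this is an equality, because the coefficient next to the
  central one is smaller by the factor \<open>m / (m + 1)\<close>. For odd \<open>p\<close> the
  values \<open>max_prob p 0\<close> and \<open>max_prob p 1\<close> agree by parity.\<close>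

lemma max_prob_1_ge: "real p * max_prob p 0 \<le> real (p + 2) * max_prob p 1"
proof (cases "even p")
  case True
  then obtain m where m: "p = 2 * m" by blast
  have "Suc m * (2 * m choose Suc m) = (2 * m - m) * (2 * m choose m)"
    using binomial_absorb_comp[of "2 * m" m] Suc_times_binomial_eq[of "2 * m - 1" m] 
    by (cases m) (auto simp: binomial_absorption)
  then have "real (Suc m) * real (2 * m choose Suc m) = real m * real (2 * m choose m)"
    by (metis add_diff_cancel_left' mult_2 of_nat_mult)
  then show ?thesis
    by (simp add: m max_prob_def divide_simps algebra_simps)
next
  case False
  then obtain m where m: "p = 2 * m + 1" by (elim oddE)
  show ?thesis
    by (auto simp: m max_prob_def divide_simps intro!: mult_right_mono)
qed

lemma tendsto_max_prob_1_ratio: "(\<lambda>p. max_prob p 1 / max_prob p 0) \<longlonglongrightarrow> 1"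
proof (rule tendsto_sandwich)
  show "\<forall>\<^sub>F p in sequentially. 1 - 2 * inverse (real (Suc p)) \<le> max_prob p 1 / max_prob p 0"
  proof (intro always_eventually allI)
    fix p
    have "1 - 2 * inverse (real (Suc p)) \<le> real p / real (p + 2)"
      by (simp add: field_simps)
    also have "\<dots> \<le> max_prob p 1 / max_prob p 0"
      using max_prob_1_ge[of p] by (simp add: field_simps)
    finally show "1 - 2 * inverse (real (Suc p)) \<le> max_prob p 1 / max_prob p 0" .
  qed
  show "\<forall>\<^sub>F p in sequentially. max_prob p 1 / max_prob p 0 \<le> 1"
    by (simp add: max_prob_le)
  have "(\<lambda>p. 1 - 2 * inverse (real (Suc p))) \<longlonglongrightarrow> 1 - 2 * 0"
    by (intro tendsto_intros LIMSEQ_inverse_real_of_nat)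
  then show "(\<lambda>p. 1 - 2 * inverse (real (Suc p))) \<longlonglongrightarrow> 1"
    by simp
qed simp

text \<open>By \<open>max_prob_Suc_0\<close> one extra step multiplies \<open>max_prob p 0\<close>
  by the mean of 1 and \<open>max_prob p 1 / max_prob p 0\<close>, which tends to 1; a shift by
  \<open>q\<close> is a product of \<open>q\<close> such factors.\<close>

lemma tendsto_max_prob_shift: "(\<lambda>p. max_prob (p + q) 0 / max_prob p 0) \<longlonglongrightarrow> 1"
proof (induction q)
  case (Suc q)
  have *: "(\<lambda>p. (1 + max_prob p 1 / max_prob p 0) / 2) \<longlonglongrightarrow> (1 + 1) / 2"
    by (intro tendsto_intros tendsto_max_prob_1_ratio) simp
  have "(\<lambda>p. (1 + max_prob (p + q) 1 / max_prob (p + q) 0) / 2 * (max_prob (p + q) 0 / max_prob p 0)) \<longlonglongrightarrow> (1 + 1) / 2 * 1"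
    by (intro tendsto_mult Suc.IH LIMSEQ_ignore_initial_segment[OF *])
  also have "(\<lambda>p. (1 + max_prob (p + q) 1 / max_prob (p + q) 0) / 2 * (max_prob (p + q) 0 / max_prob p 0))
     = (\<lambda>p. max_prob (p + Suc q) 0 / max_prob p 0)"
    by (simp add: max_prob_Suc_0 fun_eq_iff field_simps less_imp_neq[OF max_prob_0_pos, symmetric])
  finally show ?case by simp
qed (simp add: less_imp_neq[OF max_prob_0_pos, symmetric])

text \<open>Solving \<open>max_prob_Suc_Suc\<close> for the value at \<open>b + 2\<close> expresses
  its ratio through those at \<open>b + 1\<close> and \<open>b\<close> and a time shift by one, with
  limit \<open>2 * 1 * 1 - 1\<close>.\<close>

lemma tendsto_max_prob_ratio: "(\<lambda>p. max_prob p b / max_prob p 0) \<longlonglongrightarrow> 1"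
proof (induction b rule: induct_nat_012)
  case (ge2 b)
  have nz: "max_prob p 0 \<noteq> 0" for p using max_prob_0_pos[of p] by linarith
  have "(\<lambda>p. 2 * (max_prob (Suc p) (Suc b) / max_prob (Suc p) 0) * (max_prob (p + 1) 0 / max_prob p 0)
           - max_prob p b / max_prob p 0) \<longlonglongrightarrow> 2 * 1 * 1 - 1"
    by (intro tendsto_intros ge2.IH tendsto_max_prob_shift filterlim_sequentially_Suc[THEN iffD2, OF ge2.IH(2)])
  also have "(\<lambda>p. 2 * (max_prob (Suc p) (Suc b) / max_prob (Suc p) 0) * (max_prob (p + 1) 0 / max_prob p 0)
           - max_prob p b / max_prob p 0) = (\<lambda>p. max_prob p (Suc (Suc b)) / max_prob p 0)"
  proof
    fix p
    have "max_prob p (Suc (Suc b)) = 2 * max_prob (Suc p) (Suc b) - max_prob p b"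
      by (simp add: max_prob_Suc_Suc field_simps)
    then show "2 * (max_prob (Suc p) (Suc b) / max_prob (Suc p) 0) * (max_prob (p + 1) 0 / max_prob p 0)
           - max_prob p b / max_prob p 0 = max_prob p (Suc (Suc b)) / max_prob p 0"
      using nz by (simp add: field_simps)
  qed
  finally show ?case by simp
qed (use tendsto_max_prob_1_ratio in \<open>simp_all add: less_imp_neq[OF max_prob_0_pos, symmetric]\<close>)

text \<open>This is the first-step decomposition in expectation form: an up-step raises the maximum
  of the remaining walk by one, a down-step lowers it by one but not below 0. Truncated subtraction
  in \<open>b - 1\<close> encodes that barrier.\<close>

lemma sum_max_prob_reindex:
  "(\<Sum>b\<le>Suc q. max_prob (Suc q) b * g b)
    = (\<Sum>b\<le>q. max_prob q b * g (Suc b)) / 2 + (\<Sum>b\<le>q. max_prob q b * g (b - 1)) / 2"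
proof -
  have "(\<Sum>b\<le>Suc q. max_prob (Suc q) b * g b) = max_prob (Suc q) 0 * g 0 + (\<Sum>b\<le>q. max_prob (Suc q) (Suc b) * g (Suc b))"
    by (rule sum.atMost_Suc_shift)
  also have "(\<Sum>b\<le>q. max_prob (Suc q) (Suc b) * g (Suc b))
      = (\<Sum>b\<le>q. max_prob q b * g (Suc b)) / 2 + (\<Sum>b\<le>q. max_prob q (Suc (Suc b)) * g (Suc b)) / 2"
    by (simp add: max_prob_Suc_Suc sum.distrib[symmetric] sum_divide_distrib ring_distribs add_divide_distrib)
  \<comment> \<open>Both \<open>b = 0\<close> and \<open>b = 1\<close> have
    \<open>b - 1 = 0\<close>, so the two added terms complete the sum from below; its terms at
    \<open>q + 1\<close> and \<open>q + 2\<close> vanish.\<close>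
  also have "(\<Sum>b\<le>q. max_prob q (Suc (Suc b)) * g (Suc b)) + (max_prob q 0 * g 0 + max_prob q 1 * g 0)
     = (\<Sum>b\<le>Suc (Suc q). max_prob q b * g (b - 1))"
    by (simp add: sum.atMost_Suc_shift del: sum.atMost_Suc)
  then have "(\<Sum>b\<le>q. max_prob q (Suc (Suc b)) * g (Suc b))
     = (\<Sum>b\<le>q. max_prob q b * g (b - 1)) - (max_prob q 0 * g 0 + max_prob q 1 * g 0)"
    by (simp add: max_prob_eq_0)
  finally show ?thesis
    by (simp add: max_prob_Suc_0 field_simps)
qed

subsection \<open>Running maxima and the Markov property\<close>

lemma running_max_0 [simp]: "running_max 0 \<omega> = \<omega> 0"
  by (simp add: running_max_def)

lemma running_max_Suc: "running_max (Suc n) \<omega> = max (running_max n \<omega>) (\<omega> (Suc n))"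
  by (simp add: running_max_def atMost_Suc max.commute)

lemma running_max_ge: "k \<le> n \<Longrightarrow> \<omega> k \<le> running_max n \<omega>"
  by (simp add: running_max_def)

lemma running_max_le: "(\<And>k. k \<le> n \<Longrightarrow> \<omega> k \<le> c) \<Longrightarrow> running_max n \<omega> \<le> c"
  by (simp add: running_max_def)

lemma running_max_mono: "m \<le> n \<Longrightarrow> running_max m \<omega> \<le> running_max n \<omega>"
  by (auto intro!: running_max_le running_max_ge)

lemma running_max_cong: "(\<And>k. k \<le> n \<Longrightarrow> \<omega> k = \<omega>' k) \<Longrightarrow> running_max n \<omega> = running_max n \<omega>'"
  by (simp add: running_max_def)

lemma running_max_add:
  "running_max (n + q) \<omega> = max (running_max n \<omega>) (running_max q (\<lambda>k. \<omega> (n + k)))"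
proof (induction q)
  case 0
  then show ?case using running_max_ge[of n n \<omega>] by simp
qed (simp add: running_max_Suc)

lemma running_max_Suc_shift: "running_max (Suc n) \<omega> = max (\<omega> 0) (running_max n (\<lambda>k. \<omega> (Suc k)))"
  by (induction n) (simp_all add: running_max_Suc)

lemma running_max_const_add: "running_max n (\<lambda>k. a + \<omega> k) = a + running_max n \<omega>"
  by (induction n) (simp_all add: running_max_Suc)

section \<open>Splitting the coin tosses\<close>

lemma space_coin_tosses [simp]: "space coin_tosses = UNIV"
  by (simp add: coin_tosses_def space_PiM)

text \<open>Following the first \<open>n\<close> tosses of one sequence by an independent copy gives
  fair tosses again, and Fubini integrates the copy first. This is the source of the Markov property
  at time \<open>n\<close>.\<close>

lemma integral_coin_tosses_split:
  fixes f :: "(nat \<Rightarrow> bool) \<Rightarrow> real"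
  assumes f [measurable]: "f \<in> borel_measurable coin_tosses" and bound: "\<And>\<epsilon>. \<bar>f \<epsilon>\<bar> \<le> B"
  shows "(\<integral>\<epsilon>. f \<epsilon> \<partial>coin_tosses) = (\<integral>\<epsilon>. (\<integral>\<epsilon>'. f (comb_seq n \<epsilon> \<epsilon>') \<partial>coin_tosses) \<partial>coin_tosses)"
proof -
  interpret sequence_space "measure_pmf (bernoulli_pmf (1/2))"
    by unfold_locales
  interpret C: prob_space coin_tosses by (rule prob_space_coin_tosses)
  interpret CC: pair_prob_space coin_tosses coin_tosses by unfold_locales
  have meas [measurable]: "(\<lambda>(\<epsilon>, \<epsilon>'). comb_seq n \<epsilon> \<epsilon>') \<in> measurable (coin_tosses \<Otimes>\<^sub>M coin_tosses) coin_tosses"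
    unfolding coin_tosses_def by (rule measurable_comb_seq)
  have "(\<integral>\<epsilon>. f \<epsilon> \<partial>coin_tosses)
      = (\<integral>\<epsilon>. f \<epsilon> \<partial>distr (coin_tosses \<Otimes>\<^sub>M coin_tosses) coin_tosses (\<lambda>(\<epsilon>, \<epsilon>'). comb_seq n \<epsilon> \<epsilon>'))"
    using PiM_comb_seq[of n] by (simp add: coin_tosses_def)
  also have "\<dots> = (\<integral>x. f (case x of (\<epsilon>, \<epsilon>') \<Rightarrow> comb_seq n \<epsilon> \<epsilon>') \<partial>(coin_tosses \<Otimes>\<^sub>M coin_tosses))"
    by (rule integral_distr) measurable
  also have "\<dots> = (\<integral>\<epsilon>. (\<integral>\<epsilon>'. f (comb_seq n \<epsilon> \<epsilon>') \<partial>coin_tosses) \<partial>coin_tosses)"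
    using bound by (subst CC.integral_fst'[symmetric])
      (auto intro!: CC.integrable_const_bound[where B = B])
  finally show ?thesis .
qed

text \<open>A fair toss put in front of an independent sequence of tosses has the same law; this is
  what first-step analysis rests on.\<close>

lemma integral_coin_tosses_first:
  fixes f :: "(nat \<Rightarrow> bool) \<Rightarrow> real"
  assumes f [measurable]: "f \<in> borel_measurable coin_tosses" and bound: "\<And>\<epsilon>. \<bar>f \<epsilon>\<bar> \<le> B"
  shows "(\<integral>\<epsilon>. f \<epsilon> \<partial>coin_tosses)
    = (\<integral>\<epsilon>. f (case_nat True \<epsilon>) \<partial>coin_tosses) / 2 + (\<integral>\<epsilon>. f (case_nat False \<epsilon>) \<partial>coin_tosses) / 2"
proof -
  let ?b = "measure_pmf (bernoulli_pmf (1/2))"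
  interpret sequence_space ?b
    by unfold_locales
  interpret C: prob_space coin_tosses by (rule prob_space_coin_tosses)
  interpret CC: pair_prob_space ?b coin_tosses by unfold_locales
  have meas [measurable]: "(\<lambda>(s, \<epsilon>). case_nat s \<epsilon>) \<in> measurable (?b \<Otimes>\<^sub>M coin_tosses) coin_tosses"
    unfolding coin_tosses_def by measurable
  have "(\<integral>\<epsilon>. f \<epsilon> \<partial>coin_tosses)
      = (\<integral>\<epsilon>. f \<epsilon> \<partial>distr (?b \<Otimes>\<^sub>M coin_tosses) coin_tosses (\<lambda>(s, \<epsilon>). case_nat s \<epsilon>))"
    using PiM_iter by (simp add: coin_tosses_def)
  also have "\<dots> = (\<integral>x. f (case x of (s, \<epsilon>) \<Rightarrow> case_nat s \<epsilon>) \<partial>(?b \<Otimes>\<^sub>M coin_tosses))"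
    by (rule integral_distr) measurable
  also have "\<dots> = (\<integral>s. (\<integral>\<epsilon>. f (case_nat s \<epsilon>) \<partial>coin_tosses) \<partial>?b)"
    using bound by (subst CC.integral_fst'[symmetric])
      (auto intro!: CC.integrable_const_bound[where B = B])
  finally show ?thesis by simp
qed

lemma measurable_coordinate_path:
  "(\<lambda>\<omega>. \<omega> k) \<in> measurable path_algebra (count_space UNIV)"
  using coordinate_measurable[of k] by (simp add: measurable_cong_sets[OF sets_srw refl])

lemma measurable_walk [measurable]: "(\<lambda>\<epsilon>. walk_path \<epsilon> k) \<in> measurable coin_tosses (count_space UNIV)"
  by (rule measurable_compose[OF walk_path_measurable measurable_coordinate_path])

lemma measurable_running_max:
  assumes [measurable]: "\<And>k. (\<lambda>x. X x k) \<in> measurable M (count_space UNIV)"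
  shows "(\<lambda>x. running_max n (X x)) \<in> measurable M (count_space UNIV)"
proof (induction n)
  case (Suc n)
  note [measurable] = Suc
  have "(\<lambda>x. max (running_max n (X x)) (X x (Suc n))) \<in> measurable M (count_space UNIV)"
    by (rule measurable_compose_countable[where f = "\<lambda>i x. max i (X x (Suc n))"]) measurable
  then show ?case by (simp add: running_max_Suc)
qed simp

lemma walk_path_0 [simp]: "walk_path \<epsilon> 0 = 0"
  by (simp add: walk_path_def)

lemma walk_path_case_nat:
  "walk_path (case_nat x \<epsilon>) (Suc k) = (if x then 1 else -1) + walk_path \<epsilon> k"
  by (simp add: walk_path_def sum.lessThan_Suc_shift del: sum.lessThan_Suc)

lemma walk_path_comb_seq_le:
  "k \<le> n \<Longrightarrow> walk_path (comb_seq n \<epsilon> \<epsilon>') k = walk_path \<epsilon> k"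
  by (simp add: walk_path_def comb_seq_def)

lemma walk_path_comb_seq_add:
  "walk_path (comb_seq n \<epsilon> \<epsilon>') (n + k) = walk_path \<epsilon> n + walk_path \<epsilon>' k"
  by (induction k) (simp_all add: walk_path_comb_seq_le, simp_all add: walk_path_def comb_seq_def)

text \<open>The sign \<open>\<sigma>\<close> also covers the running minimum, as recurrence needs the walk to be unbounded in
  both directions.\<close>

lemma expectation_running_max:
  fixes h :: "int \<Rightarrow> real" and \<sigma> :: int
  assumes bound: "\<And>x. \<bar>h x\<bar> \<le> B" and \<sigma>: "\<sigma> = 1 \<or> \<sigma> = -1"
  shows "(\<integral>\<epsilon>. h (running_max q (\<lambda>k. \<sigma> * walk_path \<epsilon> k)) \<partial>coin_tosses)
    = (\<Sum>b\<le>q. max_prob q b * h (int b))"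
  using bound
proof (induction q arbitrary: h)
  case 0
  interpret C: prob_space coin_tosses by (rule prob_space_coin_tosses)
  show ?case using C.prob_space by (simp add: max_prob_0)
next
  case (Suc q)
  note [measurable] = measurable_running_max
  have nonneg: "0 \<le> running_max q (\<lambda>k. \<sigma> * walk_path \<epsilon> k)" for \<epsilon>
    using running_max_ge[of 0 q "\<lambda>k. \<sigma> * walk_path \<epsilon> k"] by simp
  have step: "running_max (Suc q) (\<lambda>k. \<sigma> * walk_path (case_nat x \<epsilon>) k)
      = max 0 ((if x then \<sigma> else -\<sigma>) + running_max q (\<lambda>k. \<sigma> * walk_path \<epsilon> k))" for x \<epsilon>
    by (simp add: running_max_Suc_shift walk_path_case_nat ring_distribs
         running_max_const_add[symmetric] if_distrib[of "(*) \<sigma>"] cong: if_cong)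
  have "(\<integral>\<epsilon>. h (running_max (Suc q) (\<lambda>k. \<sigma> * walk_path \<epsilon> k)) \<partial>coin_tosses)
      = (\<integral>\<epsilon>. h (max 0 (\<sigma> + running_max q (\<lambda>k. \<sigma> * walk_path \<epsilon> k))) \<partial>coin_tosses) / 2
      + (\<integral>\<epsilon>. h (max 0 (- \<sigma> + running_max q (\<lambda>k. \<sigma> * walk_path \<epsilon> k))) \<partial>coin_tosses) / 2"
    using Suc.prems by (subst integral_coin_tosses_first[where B = B]) (simp_all add: step del: mult_minus1)
  \<comment> \<open>For \<open>\<sigma> = -1\<close> the two halves merely change places, so both
    signs lead to the same recursion.\<close>
  also have "\<dots> = (\<integral>\<epsilon>. h (max 0 (1 + running_max q (\<lambda>k. \<sigma> * walk_path \<epsilon> k))) \<partial>coin_tosses) / 2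
      + (\<integral>\<epsilon>. h (max 0 (-1 + running_max q (\<lambda>k. \<sigma> * walk_path \<epsilon> k))) \<partial>coin_tosses) / 2"
    using \<sigma> by (elim disjE) (simp_all only: minus_minus add.commute)
  also have "(\<integral>\<epsilon>. h (max 0 (1 + running_max q (\<lambda>k. \<sigma> * walk_path \<epsilon> k))) \<partial>coin_tosses)
      = (\<Sum>b\<le>q. max_prob q b * h (int (Suc b)))"
    using Suc.IH[of "\<lambda>x. h (max 0 (1 + x))"] Suc.prems by (simp add: add.commute)
  also have "(\<integral>\<epsilon>. h (max 0 (-1 + running_max q (\<lambda>k. \<sigma> * walk_path \<epsilon> k))) \<partial>coin_tosses)
      = (\<Sum>b\<le>q. max_prob q b * h (max 0 (-1 + int b)))"
    using Suc.IH[of "\<lambda>x. h (max 0 (-1 + x))"] Suc.prems by simp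
  also have "\<dots> = (\<Sum>b\<le>q. max_prob q b * h (int (b - 1)))"
    by (intro sum.cong refl arg_cong2[where f = "(*)"] arg_cong[where f = h]) auto
  also have "(\<Sum>b\<le>q. max_prob q b * h (int (Suc b))) / 2 + (\<Sum>b\<le>q. max_prob q b * h (int (b - 1))) / 2
      = (\<Sum>b\<le>Suc q. max_prob (Suc q) b * h (int b))"
    using sum_max_prob_reindex[of q "\<lambda>b. h (int b)"] by simp
  finally show ?case .
qed

text \<open>Hypothesis \<open>adapted\<close> makes \<open>F\<close> a function of the first
  \<open>n\<close> tosses. After time \<open>n\<close> the maximum is the larger of the past maximum
  and the current position plus the maximum of a fresh walk of length \<open>q\<close>, whose law is
  \<open>max_prob q\<close>.\<close>

lemma expectation_running_max_markov:
  fixes h :: "int \<Rightarrow> real" and F :: "(nat \<Rightarrow> bool) \<Rightarrow> real"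
  assumes F [measurable]: "F \<in> borel_measurable coin_tosses" and F_bound: "\<And>\<epsilon>. \<bar>F \<epsilon>\<bar> \<le> A"
    and adapted: "\<And>\<epsilon> \<epsilon>'. F (comb_seq n \<epsilon> \<epsilon>') = F \<epsilon>"
    and bound: "\<And>x. \<bar>h x\<bar> \<le> B"
  shows "(\<integral>\<epsilon>. F \<epsilon> * h (running_max (n + q) (walk_path \<epsilon>)) \<partial>coin_tosses)
    = (\<integral>\<epsilon>. F \<epsilon> * (\<Sum>b\<le>q. max_prob q b * h (max (running_max n (walk_path \<epsilon>)) (walk_path \<epsilon> n + int b))) \<partial>coin_tosses)"
proof -
  note [measurable] = measurable_running_max
  have "\<bar>F \<epsilon> * h x\<bar> \<le> A * B" for \<epsilon> :: "nat \<Rightarrow> bool" and x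
    using mult_mono[OF F_bound bound] order_trans[OF abs_ge_zero F_bound] by (simp add: abs_mult)
  then have "(\<integral>\<epsilon>. F \<epsilon> * h (running_max (n + q) (walk_path \<epsilon>)) \<partial>coin_tosses)
     = (\<integral>\<epsilon>. \<integral>\<epsilon>'. F \<epsilon> * h (running_max (n + q) (walk_path (comb_seq n \<epsilon> \<epsilon>'))) \<partial>coin_tosses \<partial>coin_tosses)"
    by (subst integral_coin_tosses_split[where B = "A * B" and n = n]) (auto simp: adapted)
  also have "\<dots> = (\<integral>\<epsilon>. F \<epsilon> * (\<Sum>b\<le>q. max_prob q b * h (max (running_max n (walk_path \<epsilon>)) (walk_path \<epsilon> n + int b))) \<partial>coin_tosses)"
  proof (intro Bochner_Integration.integral_cong refl)
    fix \<epsilon>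
    have "running_max n (walk_path (comb_seq n \<epsilon> \<epsilon>')) = running_max n (walk_path \<epsilon>)" for \<epsilon>'
      by (rule running_max_cong) (simp add: walk_path_comb_seq_le)
    then have "running_max (n + q) (walk_path (comb_seq n \<epsilon> \<epsilon>'))
        = max (running_max n (walk_path \<epsilon>)) (walk_path \<epsilon> n + running_max q (walk_path \<epsilon>'))" for \<epsilon>'
      by (simp add: running_max_add walk_path_comb_seq_add running_max_const_add)
    then show "(\<integral>\<epsilon>'. F \<epsilon> * h (running_max (n + q) (walk_path (comb_seq n \<epsilon> \<epsilon>'))) \<partial>coin_tosses)
       = F \<epsilon> * (\<Sum>b\<le>q. max_prob q b * h (max (running_max n (walk_path \<epsilon>)) (walk_path \<epsilon> n + int b)))"
      using expectation_running_max[of "\<lambda>x. h (max (running_max n (walk_path \<epsilon>)) (walk_path \<epsilon> n + x))" B 1 q] bound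
      by simp
  qed
  finally show ?thesis .
qed

section \<open>Dominated convergence for sums, and decay of \<open>max_prob\<close>\<close>

lemma tendsto_sum_dominated:
  fixes a :: "nat \<Rightarrow> nat \<Rightarrow> real"
  assumes "summable g" "\<And>b. 0 \<le> g b" "\<And>q b. 0 \<le> a q b" "\<And>q b. a q b \<le> 1"
    and zero: "\<And>q b. q < b \<Longrightarrow> a q b = 0" and lim: "\<And>b. (\<lambda>q. a q b) \<longlonglongrightarrow> l b"
  shows "(\<lambda>q. \<Sum>b\<le>q. a q b * g b) \<longlonglongrightarrow> (\<Sum>b. l b * g b)"
proof -
  have "(\<lambda>q. \<Sum>b. a q b * g b) \<longlonglongrightarrow> (\<Sum>b. l b * g b)"
  proof (rule conjunct2[OF conjunct2[OF tannerys_theorem[where M = g]]])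
    have "norm (a q b * g b) \<le> g b" for q b
      using assms(2-4) by (simp add: abs_mult mult_left_le_one_le)
    then show "\<forall>\<^sub>F (b, q) in sequentially \<times>\<^sub>F sequentially. norm (a q b * g b) \<le> g b"
      by (intro always_eventually) auto
    show "(\<lambda>q. a q b * g b) \<longlonglongrightarrow> l b * g b" for b
      by (intro tendsto_intros lim)
  qed (use assms in auto)
  \<comment> \<open>The weights vanish beyond \<open>q\<close>, so the series to which Tannery's
    theorem applies is the finite sum in question.\<close>
  moreover have "(\<Sum>b. a q b * g b) = (\<Sum>b\<le>q. a q b * g b)" for q
    by (rule suminf_finite) (auto simp: zero)
  ultimately show ?thesis by simp
qed

lemma tendsto_sum_max_prob:
  assumes "summable g" "\<And>b. 0 \<le> g b"
  shows "(\<lambda>q. (\<Sum>b\<le>q. max_prob q b * g b) / max_prob q 0) \<longlonglongrightarrow> (\<Sum>b. g b)"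
  using tendsto_sum_dominated[of g "\<lambda>q b. max_prob q b / max_prob q 0" "\<lambda>_. 1"] assms
  by (simp add: max_prob_le max_prob_eq_0 tendsto_max_prob_ratio sum_divide_distrib)

lemma sum_max_prob: "(\<Sum>b\<le>q. max_prob q b) = 1"
proof -
  interpret C: prob_space coin_tosses by (rule prob_space_coin_tosses)
  show ?thesis
    using expectation_running_max[of "\<lambda>_. 1" 1 1 q] C.prob_space by simp
qed

lemma decseq_max_prob: "decseq (\<lambda>p. max_prob p 0)"
  using max_prob_le[of _ 1] by (intro decseq_SucI) (simp add: max_prob_Suc_0)

lemma tendsto_max_prob_0: "(\<lambda>p. max_prob p 0) \<longlonglongrightarrow> 0"
proof -
  \<comment> \<open>A positive limit would give infinitely many values almost the same positive probability.\<close>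
  obtain L where L: "(\<lambda>p. max_prob p 0) \<longlonglongrightarrow> L"
    using decseq_convergent[OF decseq_max_prob, of 0] by auto
  have L0: "0 \<le> L"
    by (rule LIMSEQ_le_const[OF L]) auto
  have le: "real (Suc K) * L \<le> 1" for K
  proof -
    have "(\<lambda>p. \<Sum>b\<le>K. max_prob p b / max_prob p 0 * max_prob p 0) \<longlonglongrightarrow> (\<Sum>b\<le>K. 1 * L)"
      by (intro tendsto_intros tendsto_max_prob_ratio L)
    moreover have "(\<Sum>b\<le>K. max_prob p b / max_prob p 0 * max_prob p 0) = (\<Sum>b\<le>K. max_prob p b)" for p
      by (intro sum.cong refl) (simp add: less_imp_neq[OF max_prob_0_pos, symmetric])
    moreover have "(\<Sum>b\<le>K. max_prob p b) \<le> 1" if "K \<le> p" for p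
      using sum_mono2[of "{..p}" "{..K}" "max_prob p"] that by (simp add: sum_max_prob)
    ultimately show ?thesis
      by (intro LIMSEQ_le_const2[of "\<lambda>p. \<Sum>b\<le>K. max_prob p b"]) auto
  qed
  have "\<not> 0 < L"
  proof
    assume "0 < L"
    then obtain K where "1 < real K * L"
      using reals_Archimedean3 by blast
    also have "\<dots> \<le> real (Suc K) * L"
      using L0 by (intro mult_right_mono) auto
    finally show False using le[of K] by simp
  qed
  with L0 L show ?thesis by simp
qed

section \<open>Bounds on the walk, transfer from path space, and the process
  \<open>M_pen\<close>\<close>

lemma abs_walk_path_le: "\<bar>walk_path \<epsilon> k\<bar> \<le> int k"
proof (induction k)
  case (Suc k)
  have "walk_path \<epsilon> (Suc k) = walk_path \<epsilon> k + (if \<epsilon> k then 1 else - 1)"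
    by (simp add: walk_path_def)
  with Suc show ?case by (simp split: if_splits)
qed simp

lemma running_max_walk_bounds: "0 \<le> running_max n (walk_path \<epsilon>)" "running_max n (walk_path \<epsilon>) \<le> int n"
proof -
  show "0 \<le> running_max n (walk_path \<epsilon>)"
    using running_max_ge[of 0 n "walk_path \<epsilon>"] by simp
  show "running_max n (walk_path \<epsilon>) \<le> int n"
  proof (rule running_max_le)
    fix k assume "k \<le> n"
    then show "walk_path \<epsilon> k \<le> int n"
      using abs_walk_path_le[of \<epsilon> k] by linarith
  qed
qed

lemma integral_srw:
  fixes f :: "(nat \<Rightarrow> int) \<Rightarrow> real"
  assumes "f \<in> borel_measurable path_algebra"
  shows "(\<integral>\<omega>. f \<omega> \<partial>srw) = (\<integral>\<epsilon>. f (walk_path \<epsilon>) \<partial>coin_tosses)"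
  unfolding srw_def by (rule integral_distr[OF walk_path_measurable assms])

text \<open>The sets that do not separate the two paths form a sigma-algebra on \<open>paths\<close>
  containing the generators of \<open>\<F> n\<close>. Applied to spliced tosses, this makes the
  indicator of \<Lambda> adapted.\<close>

lemma event_determined:
  assumes "\<Lambda> \<in> \<F> n" "\<omega> \<in> paths" "\<omega>' \<in> paths" "\<And>k. k \<le> n \<Longrightarrow> \<omega> k = \<omega>' k"
  shows "\<omega> \<in> \<Lambda> \<longleftrightarrow> \<omega>' \<in> \<Lambda>"
  using assms(1) unfolding \<F>_def
  by (induction rule: sigma_sets.induct) (use assms(2-4) in auto)

text \<open>This is where the shape of \<open>M_pen\<close> comes from: the first
  \<open>s - x\<close> terms are stuck at level \<open>s\<close>, and the later ones run through the
  tail of \<phi>.\<close>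

lemma sums_max_shift:
  fixes s x :: int
  assumes "summable \<phi>" "x \<le> s" and s: "0 \<le> s"
  shows "(\<lambda>b. \<phi> (nat (max s (x + int b)))) sums (\<phi> (nat s) * of_int (s - x) + tail \<phi> (nat s))"
proof -
  define d where "d = nat (s - x)"
  have "(\<lambda>b. \<phi> (nat s + b)) sums tail \<phi> (nat s)"
    unfolding tail_def
    using summable_ignore_initial_segment[OF assms(1), of "nat s"] by (intro summable_sums) (simp add: add.commute)
  moreover have "nat (max s (x + int (b + d))) = nat s + b" for b
    using s assms(2) by (simp add: d_def max_def nat_add_distrib)
  ultimately have "(\<lambda>b. \<phi> (nat (max s (x + int (b + d))))) sums tail \<phi> (nat s)"
    by simp
  moreover have "(\<Sum>b<d. \<phi> (nat (max s (x + int b)))) = (\<Sum>b<d. \<phi> (nat s))"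
    by (intro sum.cong refl) (auto simp: d_def max_def)
  moreover have "real d = of_int (s - x)"
    using assms(2) by (simp add: d_def)
  ultimately show ?thesis
    using sums_iff_shift[of "\<lambda>b. \<phi> (nat (max s (x + int b)))" d "tail \<phi> (nat s)"]
    by (simp only: sum_constant card_lessThan mult.commute add.commute)
qed

lemma measurable_running_max_path: "(\<lambda>\<omega>. running_max n \<omega>) \<in> measurable path_algebra (count_space UNIV)"
  by (rule measurable_running_max[OF measurable_coordinate_path])

text \<open>Freezing one of the countably many values of the running maximum leaves a function of a
  single coordinate.\<close>

lemma measurable_M_pen: "M_pen \<phi> n \<in> borel_measurable path_algebra"
proof -
  have "(\<lambda>\<omega>. \<phi> (nat i) * of_int (i - \<omega> n) + tail \<phi> (nat i)) \<in> borel_measurable path_algebra" for i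
    by (rule measurable_compose[OF measurable_coordinate_path]) simp
  from measurable_compose_countable[OF this measurable_running_max_path]
  show ?thesis by (simp add: M_pen_def[abs_def])
qed

lemma tail_properties:
  assumes nonneg: "\<And>k. 0 \<le> \<phi> k" and total_mass: "\<phi> sums 1"
  shows tail_0: "tail \<phi> 0 = 1" and tail_Suc: "tail \<phi> k = \<phi> k + tail \<phi> (Suc k)"
    and tail_nonneg: "0 \<le> tail \<phi> k" and tail_le_1: "tail \<phi> k \<le> 1"
    and le_tail: "k \<le> m \<Longrightarrow> \<phi> m \<le> tail \<phi> k"
proof -
  have summable: "summable \<phi>" using total_mass by (rule sums_summable)
  have tail: "tail \<phi> k = 1 - (\<Sum>i<k. \<phi> i)" for k
    using suminf_minus_initial_segment[OF summable, of k] sums_unique[OF total_mass]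
    by (simp add: tail_def add.commute)
  then show "tail \<phi> 0 = 1" "tail \<phi> k = \<phi> k + tail \<phi> (Suc k)"
    by simp_all
  show "tail \<phi> k \<le> 1" using tail[of k] sum_nonneg[of "{..<k}" \<phi>] nonneg by simp
  show "0 \<le> tail \<phi> k"
    unfolding tail_def using summable_ignore_initial_segment[OF summable, of k] nonneg
    by (intro suminf_nonneg) (simp_all add: add.commute)
  show "\<phi> m \<le> tail \<phi> k" if "k \<le> m"
    using sum_le_suminf[OF summable_ignore_initial_segment[OF summable, of k], of "{m - k}"] nonneg that
    by (simp add: tail_def add.commute)
qed

text \<open>Both the maximum and the position lie within distance \<open>n\<close> of 0, while
  \<phi> and its tail are at most 1. The resulting constant serves as the dominating function
  below.\<close>

lemma M_pen_walk_bounds: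
  assumes nonneg: "\<And>k. 0 \<le> \<phi> k" and total_mass: "\<phi> sums 1"
  shows "0 \<le> M_pen \<phi> n (walk_path \<epsilon>)" "M_pen \<phi> n (walk_path \<epsilon>) \<le> 2 * real n + 1"
proof -
  let ?s = "running_max n (walk_path \<epsilon>)" and ?x = "walk_path \<epsilon> n"
  have le1: "\<phi> k \<le> 1" for k
    using le_tail[OF nonneg total_mass, of k k] tail_le_1[OF nonneg total_mass, of k] by simp
  have d: "0 \<le> ?s - ?x" "?s - ?x \<le> 2 * int n"
    using running_max_ge[of n n "walk_path \<epsilon>"] running_max_walk_bounds(2)[of n \<epsilon>]
      abs_walk_path_le[of \<epsilon> n] by linarith+
  then have d': "0 \<le> real_of_int (?s - ?x)" "real_of_int (?s - ?x) \<le> 2 * real n"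
    by linarith+
  have "\<phi> (nat ?s) * real_of_int (?s - ?x) \<le> 1 * (2 * real n)"
    using le1 d' nonneg by (intro mult_mono) auto
  moreover have "0 \<le> \<phi> (nat ?s) * real_of_int (?s - ?x)"
    using d' nonneg by (intro mult_nonneg_nonneg) auto
  ultimately show "0 \<le> M_pen \<phi> n (walk_path \<epsilon>)" "M_pen \<phi> n (walk_path \<epsilon>) \<le> 2 * real n + 1"
    using tail_nonneg[OF nonneg total_mass, of "nat ?s"] tail_le_1[OF nonneg total_mass, of "nat ?s"]
    by (simp_all add: M_pen_def)
qed

subsection \<open>Asymptotics on a fixed event\<close>

lemma tendsto_event_running_max:
  assumes nonneg: "\<And>k. 0 \<le> \<phi> k" and total_mass: "\<phi> sums 1" and event: "\<Lambda> \<in> \<F> n"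
  shows "(\<lambda>p. (\<integral>\<omega>. indicator \<Lambda> \<omega> * \<phi> (nat (running_max p \<omega>)) \<partial>srw) / max_prob p 0)
    \<longlonglongrightarrow> (\<integral>\<omega>. indicator \<Lambda> \<omega> * M_pen \<phi> n \<omega> \<partial>srw)" (is "?N \<longlonglongrightarrow> ?M")
proof -
  interpret C: prob_space coin_tosses by (rule prob_space_coin_tosses)
  have summable: "summable \<phi>" using total_mass by (rule sums_summable)
  have le1: "\<bar>\<phi> k\<bar> \<le> 1" for k
    using le_tail[OF nonneg total_mass, of 0 k] nonneg[of k] by (simp add: tail_0[OF nonneg total_mass])
  have \<Lambda> [measurable]: "\<Lambda> \<in> sets path_algebra"
    using event filtration_subset by auto
  note [measurable] = measurable_running_max_path measurable_M_pen
    measurable_running_max[OF measurable_walk] walk_path_measurable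
  let ?s = "\<lambda>\<epsilon>. running_max n (walk_path \<epsilon>)" and ?x = "\<lambda>\<epsilon>. walk_path \<epsilon> n"
  \<comment> \<open>\<open>G q\<close> is the conditional expectation of \<phi> at the maximum up to
    time \<open>n + q\<close>, given the first \<open>n\<close> tosses.\<close>
  define G where "G q \<epsilon> = (\<Sum>b\<le>q. max_prob q b * \<phi> (nat (max (?s \<epsilon>) (?x \<epsilon> + int b))))" for q \<epsilon>
  have G_meas [measurable]: "G q \<in> borel_measurable coin_tosses" for q
  proof -
    have "(\<lambda>\<epsilon>. \<Sum>b\<le>q. max_prob q b * \<phi> (nat (max i (?x \<epsilon> + int b)))) \<in> borel_measurable coin_tosses" for i
      by (rule measurable_compose[OF measurable_walk]) simp
    from measurable_compose_countable[OF this measurable_running_max[OF measurable_walk]]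
    show ?thesis by (simp add: G_def[abs_def])
  qed
  have series: "(\<lambda>b. \<phi> (nat (max (?s \<epsilon>) (?x \<epsilon> + int b)))) sums M_pen \<phi> n (walk_path \<epsilon>)" for \<epsilon>
    unfolding M_pen_def
    by (intro sums_max_shift summable running_max_ge order_refl running_max_walk_bounds)
  have G_lim: "(\<lambda>q. G q \<epsilon> / max_prob q 0) \<longlonglongrightarrow> M_pen \<phi> n (walk_path \<epsilon>)" for \<epsilon>
    using tendsto_sum_max_prob[OF sums_summable[OF series]] sums_unique[OF series]
    by (simp add: G_def nonneg)
  \<comment> \<open>Replacing every \<open>max_prob q b\<close> by the larger
    \<open>max_prob q 0\<close> bounds the ratio by a partial sum of the series for
    \<open>M_pen\<close>, uniformly in \<open>q\<close>.\<close>
  have G_bound: "\<bar>G q \<epsilon> / max_prob q 0\<bar> \<le> 2 * real n + 1" for q \<epsilon>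
  proof -
    have G0: "0 \<le> G q \<epsilon>"
      by (auto simp: G_def nonneg intro!: sum_nonneg)
    have "G q \<epsilon> \<le> (\<Sum>b\<le>q. max_prob q 0 * \<phi> (nat (max (?s \<epsilon>) (?x \<epsilon> + int b))))"
      unfolding G_def by (intro sum_mono mult_right_mono max_prob_le nonneg)
    also have "\<dots> = max_prob q 0 * (\<Sum>b\<le>q. \<phi> (nat (max (?s \<epsilon>) (?x \<epsilon> + int b))))"
      by (simp add: sum_distrib_left)
    also have "\<dots> \<le> max_prob q 0 * M_pen \<phi> n (walk_path \<epsilon>)"
      unfolding sums_unique[OF series]
      by (intro mult_left_mono sum_le_suminf sums_summable[OF series]) (auto simp: nonneg)
    finally have "G q \<epsilon> / max_prob q 0 \<le> M_pen \<phi> n (walk_path \<epsilon>)"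
      by (simp add: divide_le_eq mult.commute)
    also have "\<dots> \<le> 2 * real n + 1"
      by (rule M_pen_walk_bounds[OF nonneg total_mass])
    finally show ?thesis using G0 by simp
  qed
  have markov: "(\<integral>\<omega>. indicator \<Lambda> \<omega> * \<phi> (nat (running_max (n + q) \<omega>)) \<partial>srw)
     = (\<integral>\<epsilon>. indicator \<Lambda> (walk_path \<epsilon>) * G q \<epsilon> \<partial>coin_tosses)" for q
  proof -
    have "walk_path (comb_seq n \<epsilon> \<epsilon>') \<in> \<Lambda> \<longleftrightarrow> walk_path \<epsilon> \<in> \<Lambda>" for \<epsilon> \<epsilon>'
      by (intro event_determined[OF event] walk_path_in_paths walk_path_comb_seq_le)
    then show ?thesis
      unfolding G_def
      using expectation_running_max_markov[of "\<lambda>\<epsilon>. indicator \<Lambda> (walk_path \<epsilon>)" 1 n "\<lambda>x. \<phi> (nat x)" 1 q] le1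
      by (subst integral_srw) (auto simp: indicator_def)
  qed
  have "(\<lambda>q. \<integral>\<epsilon>. indicator \<Lambda> (walk_path \<epsilon>) * (G q \<epsilon> / max_prob q 0) \<partial>coin_tosses)
     \<longlonglongrightarrow> (\<integral>\<epsilon>. indicator \<Lambda> (walk_path \<epsilon>) * M_pen \<phi> n (walk_path \<epsilon>) \<partial>coin_tosses)"
  proof (rule integral_dominated_convergence[where w = "\<lambda>_. 2 * real n + 1"])
    show "(\<lambda>\<epsilon>. indicator \<Lambda> (walk_path \<epsilon>) * M_pen \<phi> n (walk_path \<epsilon>)) \<in> borel_measurable coin_tosses"
      by measurable
    show "(\<lambda>\<epsilon>. indicator \<Lambda> (walk_path \<epsilon>) * (G q \<epsilon> / max_prob q 0)) \<in> borel_measurable coin_tosses" for q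
      by measurable
    show "AE \<epsilon> in coin_tosses. (\<lambda>q. indicator \<Lambda> (walk_path \<epsilon>) * (G q \<epsilon> / max_prob q 0))
        \<longlonglongrightarrow> indicator \<Lambda> (walk_path \<epsilon>) * M_pen \<phi> n (walk_path \<epsilon>)"
      by (intro AE_I2 tendsto_intros G_lim)
    show "AE \<epsilon> in coin_tosses. norm (indicator \<Lambda> (walk_path \<epsilon>) * (G q \<epsilon> / max_prob q 0)) \<le> 2 * real n + 1" for q
      using G_bound by (intro AE_I2) (simp add: indicator_def del: abs_divide)
  qed simp
  also have "(\<integral>\<epsilon>. indicator \<Lambda> (walk_path \<epsilon>) * M_pen \<phi> n (walk_path \<epsilon>) \<partial>coin_tosses) = ?M"
    by (subst integral_srw) simp_all
  also have "(\<lambda>q. \<integral>\<epsilon>. indicator \<Lambda> (walk_path \<epsilon>) * (G q \<epsilon> / max_prob q 0) \<partial>coin_tosses)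
      = (\<lambda>q. ?N (q + n) * (max_prob (q + n) 0 / max_prob q 0))"
    by (simp add: markov[symmetric] add.commute less_imp_neq[OF max_prob_0_pos, symmetric])
  \<comment> \<open>Dividing by the shift ratio, which tends to 1, changes the normaliser from
    \<open>max_prob q 0\<close> to \<open>max_prob (q + n) 0\<close>.\<close>
  finally have "(\<lambda>q. ?N (q + n) * (max_prob (q + n) 0 / max_prob q 0) / (max_prob (q + n) 0 / max_prob q 0)) \<longlonglongrightarrow> ?M / 1"
    by (intro tendsto_divide tendsto_max_prob_shift) simp_all
  then have "(\<lambda>q. ?N (q + n)) \<longlonglongrightarrow> ?M"
    by (simp add: less_imp_neq[OF max_prob_0_pos, symmetric])
  then show ?thesis
    by (rule LIMSEQ_offset)
qed

subsection \<open>Ending at a positive point below a fixed level\<close>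

text \<open>From such a point the next \<open>b\<close> steps are all upward with probability \<open>2\<^sup>-\<^sup>b\<close>, which lifts the
  maximum above \<open>b\<close>. Hence the probability in question is at most
  \<open>2\<^sup>b (P(S\<^sub>p \<le> b) - P(S\<^bsub>p+b\<^esub> \<le> b))\<close>, and both terms are asymptotic to \<open>(b + 1) c\<^sub>p\<close>.\<close>

lemma tendsto_max_le_end_pos:
  "(\<lambda>p. (\<integral>\<epsilon>. indicator {..int b} (running_max p (walk_path \<epsilon>)) * indicator {0<..} (walk_path \<epsilon> p) \<partial>coin_tosses)
     / max_prob p 0) \<longlonglongrightarrow> (0 :: real)"
proof -
  interpret C: prob_space coin_tosses by (rule prob_space_coin_tosses)
  let ?S = "\<lambda>p \<epsilon>. running_max p (walk_path \<epsilon>)"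
  define I where "I x = (indicator {..int b} x :: real)" for x :: int
  define J where "J p \<epsilon> = I (?S p \<epsilon>) * indicator {0<..} (walk_path \<epsilon> p)" for p \<epsilon>
  define Q where "Q p = (\<integral>\<epsilon>. I (?S p \<epsilon>) \<partial>coin_tosses)" for p
  have I_bound: "0 \<le> I x" "I x \<le> 1" "\<bar>I x\<bar> \<le> 1" for x
    by (auto simp: I_def indicator_def)
  have I_meas: "(\<lambda>\<epsilon>. I (?S p \<epsilon>)) \<in> borel_measurable coin_tosses" for p
    by (rule measurable_compose[OF measurable_running_max[OF measurable_walk]]) simp
  have J_meas: "J p \<in> borel_measurable coin_tosses" for p
    unfolding J_def
    by (intro borel_measurable_times I_meas measurable_compose[OF measurable_walk]) simp_all
  have Q_eq: "Q p = (\<Sum>j\<le>p. max_prob p j * I (int j))" for p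
    using expectation_running_max[of I 1 1 p] I_bound by (simp add: Q_def)
  have Q_lim: "(\<lambda>p. Q p / max_prob p 0) \<longlonglongrightarrow> (\<Sum>j. I (int j))"
    unfolding Q_eq
  proof (rule tendsto_sum_max_prob)
    show "summable (\<lambda>j. I (int j))"
      by (rule summable_finite[of "{..b}"]) (auto simp: I_def)
  qed (simp add: I_bound)
  have upper: "Q (p + b) + (1 / 2 ^ b) * (\<integral>\<epsilon>. J p \<epsilon> \<partial>coin_tosses) \<le> Q p" for p
  proof -
    let ?G = "\<lambda>\<epsilon>. \<Sum>j\<le>b. max_prob b j * I (max (?S p \<epsilon>) (walk_path \<epsilon> p + int j))"
    have G_meas: "?G \<in> borel_measurable coin_tosses"
    proof -
      have "(\<lambda>\<epsilon>. \<Sum>j\<le>b. max_prob b j * I (max i (walk_path \<epsilon> p + int j))) \<in> borel_measurable coin_tosses" for i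
        by (rule measurable_compose[OF measurable_walk]) simp
      from measurable_compose_countable[OF this measurable_running_max[OF measurable_walk]]
      show ?thesis by simp
    qed
    have G_bound: "0 \<le> ?G \<epsilon>" "?G \<epsilon> \<le> 1" for \<epsilon>
    proof -
      show "0 \<le> ?G \<epsilon>" by (intro sum_nonneg mult_nonneg_nonneg I_bound) simp
      have "?G \<epsilon> \<le> (\<Sum>j\<le>b. max_prob b j * 1)"
        by (intro sum_mono mult_left_mono I_bound) simp
      then show "?G \<epsilon> \<le> 1" by (simp add: sum_max_prob)
    qed
    have step: "I (?S p \<epsilon>) * ?G \<epsilon> + (1 / 2 ^ b) * J p \<epsilon> \<le> I (?S p \<epsilon>)" for \<epsilon>
    proof (cases "?S p \<epsilon> \<le> int b \<and> 0 < walk_path \<epsilon> p")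
      case True
      \<comment> \<open>The position is at least 1, so a further rise by \<open>b\<close> passes
        level \<open>b\<close>: the term \<open>j = b\<close> drops out, at a cost of
        \<open>max_prob b b = 1 / 2 ^ b\<close>.\<close>
      have "?G \<epsilon> \<le> (\<Sum>j\<le>b. max_prob b j * (if j = b then 0 else 1))"
        using True by (intro sum_mono mult_left_mono) (auto simp: I_def indicator_def)
      also have "\<dots> = (\<Sum>j\<le>b. max_prob b j) - max_prob b b"
        by (simp add: sum.remove[of "{..b}" b] if_distrib[of "(*) _"] sum.If_cases Diff_eq cong: if_cong)
      finally show ?thesis
        using True by (simp add: J_def I_def sum_max_prob)
    next
      case False
      then have "J p \<epsilon> = 0" by (auto simp: J_def I_def indicator_def)
      then show ?thesis using mult_left_le[OF G_bound(2) I_bound(1)] by simp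
    qed
    have int_G: "integrable coin_tosses (\<lambda>\<epsilon>. I (?S p \<epsilon>) * ?G \<epsilon>)"
    proof (intro C.integrable_const_bound[where B = 1] AE_I2)
      show "norm (I (?S p \<epsilon>) * ?G \<epsilon>) \<le> 1" for \<epsilon>
        using mult_le_one[OF I_bound(2) G_bound] mult_nonneg_nonneg[OF I_bound(1) G_bound(1)]
        by (simp only: real_norm_def abs_of_nonneg)
      show "(\<lambda>\<epsilon>. I (?S p \<epsilon>) * ?G \<epsilon>) \<in> borel_measurable coin_tosses"
        by (intro borel_measurable_times I_meas G_meas)
    qed
    have int_J: "integrable coin_tosses (J p)"
      by (intro C.integrable_const_bound[where B = 1] AE_I2 J_meas) (simp add: J_def I_def indicator_def)
    have int_I: "integrable coin_tosses (\<lambda>\<epsilon>. I (?S p \<epsilon>))"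
      by (intro C.integrable_const_bound[where B = 1] AE_I2 I_meas) (simp add: I_bound)
    \<comment> \<open>Since the maximum grows with time, the constraint at time \<open>p\<close> may
      be inserted as a factor; it plays the part of \<open>F\<close> in the Markov property.\<close>
    have "Q (p + b) = (\<integral>\<epsilon>. I (?S p \<epsilon>) * I (?S (p + b) \<epsilon>) \<partial>coin_tosses)"
      unfolding Q_def
    proof (intro Bochner_Integration.integral_cong refl)
      show "I (?S (p + b) \<epsilon>) = I (?S p \<epsilon>) * I (?S (p + b) \<epsilon>)" for \<epsilon>
        using running_max_mono[of p "p + b" "walk_path \<epsilon>"] by (auto simp: I_def indicator_def)
    qed
    also have "\<dots> = (\<integral>\<epsilon>. I (?S p \<epsilon>) * ?G \<epsilon> \<partial>coin_tosses)"
    proof (rule expectation_running_max_markov[where A = 1 and B = 1])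
      show "I (?S p (comb_seq p \<epsilon> \<epsilon>')) = I (?S p \<epsilon>)" for \<epsilon> \<epsilon>'
        using running_max_cong[of p "walk_path (comb_seq p \<epsilon> \<epsilon>')" "walk_path \<epsilon>"]
        by (simp add: walk_path_comb_seq_le)
    qed (rule I_meas I_bound)+
    finally have "Q (p + b) + (1 / 2 ^ b) * (\<integral>\<epsilon>. J p \<epsilon> \<partial>coin_tosses)
       = (\<integral>\<epsilon>. I (?S p \<epsilon>) * ?G \<epsilon> + (1 / 2 ^ b) * J p \<epsilon> \<partial>coin_tosses)"
      using int_G int_J by (simp only: Bochner_Integration.integral_add integrable_mult_right
          integral_mult_right_zero)
    also have "\<dots> \<le> Q p"
      unfolding Q_def
      by (intro integral_mono step Bochner_Integration.integrable_add integrable_mult_right int_G int_J int_I)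
    finally show ?thesis .
  qed
  have J_nonneg: "0 \<le> (\<integral>\<epsilon>. J p \<epsilon> \<partial>coin_tosses)" for p
    by (intro Bochner_Integration.integral_nonneg) (auto simp: J_def I_def)
  \<comment> \<open>After normalisation both probabilities have the same limit, so their difference
    vanishes even against the fixed factor \<open>2 ^ b\<close>.\<close>
  have "(\<lambda>p. 2 ^ b * (Q p / max_prob p 0 - Q (p + b) / max_prob (p + b) 0 * (max_prob (p + b) 0 / max_prob p 0)))
      \<longlonglongrightarrow> 2 ^ b * ((\<Sum>j. I (int j)) - (\<Sum>j. I (int j)) * 1)"
    by (intro tendsto_intros Q_lim tendsto_max_prob_shift LIMSEQ_ignore_initial_segment[OF Q_lim])
  then have lim: "(\<lambda>p. 2 ^ b * (Q p - Q (p + b)) / max_prob p 0) \<longlonglongrightarrow> 0"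
    by (simp add: less_imp_neq[OF max_prob_0_pos, symmetric] diff_divide_distrib right_diff_distrib)
  have "(\<lambda>p. (\<integral>\<epsilon>. J p \<epsilon> \<partial>coin_tosses) / max_prob p 0) \<longlonglongrightarrow> 0"
  proof (rule tendsto_sandwich[OF _ _ tendsto_const lim])
    show "\<forall>\<^sub>F p in sequentially. 0 \<le> (\<integral>\<epsilon>. J p \<epsilon> \<partial>coin_tosses) / max_prob p 0"
      using J_nonneg by simp
    have "(\<integral>\<epsilon>. J p \<epsilon> \<partial>coin_tosses) \<le> 2 ^ b * (Q p - Q (p + b))" for p
      using upper[of p] by (simp add: field_simps)
    then show "\<forall>\<^sub>F p in sequentially. (\<integral>\<epsilon>. J p \<epsilon> \<partial>coin_tosses) / max_prob p 0
        \<le> 2 ^ b * (Q p - Q (p + b)) / max_prob p 0"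
      by (intro always_eventually allI divide_right_mono) simp_all
  qed
  then show ?thesis
    by (simp add: J_def I_def)
qed

text \<open>Extends the estimate for a single level to a summable weight. The probability of maximum
  \<open>b\<close> and a positive endpoint is at most \<open>max_prob p b\<close>, hence at most
  \<open>max_prob p 0\<close>, so dominated convergence allows summing over the levels.\<close>

lemma tendsto_weighted_end_pos:
  assumes "summable \<psi>" and nonneg: "\<And>k. 0 \<le> \<psi> k"
  shows "(\<lambda>p. (\<integral>\<epsilon>. \<psi> (nat (running_max p (walk_path \<epsilon>))) * indicator {0<..} (walk_path \<epsilon> p) \<partial>coin_tosses)
     / max_prob p 0) \<longlonglongrightarrow> (0 :: real)"
proof -
  interpret C: prob_space coin_tosses by (rule prob_space_coin_tosses)
  let ?S = "\<lambda>p \<epsilon>. running_max p (walk_path \<epsilon>)" and ?X = "\<lambda>p \<epsilon>. indicator {0<..} (walk_path \<epsilon> p) :: real"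
  have S_meas: "(\<lambda>\<epsilon>. h (?S p \<epsilon>)) \<in> borel_measurable coin_tosses" for h :: "int \<Rightarrow> real" and p
    by (rule measurable_compose[OF measurable_running_max[OF measurable_walk]]) simp
  have X_meas: "?X p \<in> borel_measurable coin_tosses" for p
    by (rule measurable_compose[OF measurable_walk]) simp
  have int: "integrable coin_tosses (\<lambda>\<epsilon>. indicator A (?S p \<epsilon>) * ?X p \<epsilon>)"
    "integrable coin_tosses (\<lambda>\<epsilon>. indicator A (?S p \<epsilon>) :: real)" for p A
    by (intro C.integrable_const_bound[where B = 1] borel_measurable_times S_meas X_meas;
        simp add: indicator_def)+
  define P where "P p b = (\<integral>\<epsilon>. indicator {int b} (?S p \<epsilon>) * ?X p \<epsilon> \<partial>coin_tosses)" for p b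
  have P_nonneg: "0 \<le> P p b" for p b
    unfolding P_def by (intro Bochner_Integration.integral_nonneg) simp
  have P_le: "P p b \<le> (\<integral>\<epsilon>. indicator {..int b} (?S p \<epsilon>) * ?X p \<epsilon> \<partial>coin_tosses)" for p b
    unfolding P_def by (intro integral_mono int) (auto simp: indicator_def)
  have P_le_max_prob: "P p b \<le> max_prob p b" for p b
  proof -
    have "P p b \<le> (\<integral>\<epsilon>. indicator {int b} (?S p \<epsilon>) \<partial>coin_tosses)"
      unfolding P_def by (intro integral_mono int) (auto simp: indicator_def)
    also have "\<dots> = (\<Sum>j\<le>p. max_prob p j * indicator {int b} (int j))"
      using expectation_running_max[of "indicator {int b}" 1 1 p] by (simp add: indicator_def)
    also have "\<dots> \<le> max_prob p b"
      by (subst sum.cong[OF refl, of _ _ "\<lambda>j. if j = b then max_prob p b else 0"])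
        (auto simp: indicator_def)
    finally show ?thesis .
  qed
  have "(\<integral>\<epsilon>. \<psi> (nat (?S p \<epsilon>)) * ?X p \<epsilon> \<partial>coin_tosses) = (\<Sum>b\<le>p. P p b * \<psi> b)" for p
  proof -
    have "\<psi> (nat (?S p \<epsilon>)) * ?X p \<epsilon> = (\<Sum>b\<le>p. indicator {int b} (?S p \<epsilon>) * ?X p \<epsilon> * \<psi> b)" for \<epsilon>
    proof -
      have "(\<Sum>b\<le>p. indicator {int b} (?S p \<epsilon>) * ?X p \<epsilon> * \<psi> b)
          = (\<Sum>b\<le>p. if b = nat (?S p \<epsilon>) then ?X p \<epsilon> * \<psi> b else 0)"
        using running_max_walk_bounds(1)[of p \<epsilon>] by (intro sum.cong) (auto simp: indicator_def)
      also have "\<dots> = \<psi> (nat (?S p \<epsilon>)) * ?X p \<epsilon>"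
        using running_max_walk_bounds(2)[of p \<epsilon>] by simp
      finally show ?thesis by simp
    qed
    then show ?thesis
      by (simp add: P_def Bochner_Integration.integral_sum int del: mult.assoc)
  qed
  moreover have "(\<lambda>p. \<Sum>b\<le>p. P p b / max_prob p 0 * \<psi> b) \<longlonglongrightarrow> (\<Sum>b. 0 * \<psi> b)"
  proof (rule tendsto_sum_dominated[OF assms])
    show "P p b / max_prob p 0 \<le> 1" for p b
      using order_trans[OF P_le_max_prob max_prob_le] by simp
    show "P p b / max_prob p 0 = 0" if "p < b" for p b
      using P_le_max_prob[of p b] P_nonneg[of p b] that by (simp add: max_prob_eq_0)
    show "(\<lambda>p. P p b / max_prob p 0) \<longlonglongrightarrow> 0" for b
    proof (rule tendsto_sandwich[OF _ _ tendsto_const tendsto_max_le_end_pos])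
      show "\<forall>\<^sub>F p in sequentially. P p b / max_prob p 0
        \<le> (\<integral>\<epsilon>. indicator {..int b} (?S p \<epsilon>) * ?X p \<epsilon> \<partial>coin_tosses) / max_prob p 0"
        by (intro always_eventually allI divide_right_mono P_le) simp
    qed (simp add: P_nonneg)
  qed (simp add: P_nonneg)
  ultimately show ?thesis
    by (simp add: sum_divide_distrib)
qed

subsection \<open>Recurrence\<close>

text \<open>Staying below \<open>K\<close> forever forces the maximum up to every time
  \<open>q\<close> to be at most \<open>K\<close>, which has probability at most
  \<open>(K + 1) * max_prob q 0\<close> and hence tends to 0.\<close>

lemma AE_walk_unbounded:
  fixes \<sigma> :: int
  assumes \<sigma>: "\<sigma> = 1 \<or> \<sigma> = -1"
  shows "AE \<epsilon> in coin_tosses. \<forall>K. \<exists>k. int K < \<sigma> * walk_path \<epsilon> k"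
  unfolding AE_all_countable
proof
  fix K
  interpret C: prob_space coin_tosses by (rule prob_space_coin_tosses)
  let ?S = "\<lambda>q \<epsilon>. running_max q (\<lambda>k. \<sigma> * walk_path \<epsilon> k)"
  have meas: "(\<lambda>\<epsilon>. \<sigma> * walk_path \<epsilon> k) \<in> measurable coin_tosses (count_space UNIV)" for k
    by (rule measurable_compose[OF measurable_walk]) simp
  note [measurable] = meas
  let ?B = "{\<epsilon> \<in> space coin_tosses. \<forall>k. \<not> int K < \<sigma> * walk_path \<epsilon> k}"
  have B [measurable]: "?B \<in> sets coin_tosses"
    by measurable
  have le_meas: "{\<epsilon> \<in> space coin_tosses. ?S q \<epsilon> \<in> {..int K}} \<in> sets coin_tosses" for q
    using measurable_sets[OF measurable_running_max[OF meas], of "{..int K}" q]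
    by (simp add: vimage_def Int_def)
  have le: "C.prob ?B \<le> real (Suc K) * max_prob q 0" for q
  proof -
    have "C.prob ?B \<le> C.prob {\<epsilon> \<in> space coin_tosses. ?S q \<epsilon> \<in> {..int K}}"
      by (intro C.finite_measure_mono le_meas) (auto intro!: running_max_le simp: not_less)
    also have "\<dots> = (\<integral>\<epsilon>. indicator {\<epsilon> \<in> space coin_tosses. ?S q \<epsilon> \<in> {..int K}} \<epsilon> \<partial>coin_tosses)"
      by simp
    also have "\<dots> = (\<integral>\<epsilon>. indicator {..int K} (?S q \<epsilon>) \<partial>coin_tosses)"
      by (intro Bochner_Integration.integral_cong) (auto simp: indicator_def)
    also have "\<dots> = (\<Sum>j\<le>q. max_prob q j * indicator {..int K} (int j))"
      using \<sigma> by (intro expectation_running_max[where B = 1]) (auto simp: indicator_def)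
    also have "\<dots> = (\<Sum>j\<in>{..q} \<inter> {..K}. max_prob q j)"
      by (simp only: sum.inter_restrict[OF finite_atMost], intro sum.cong) (simp_all add: indicator_def)
    also have "\<dots> \<le> (\<Sum>j\<le>K. max_prob q j)"
      by (rule sum_mono2) simp_all
    also have "\<dots> \<le> (\<Sum>j\<le>K. max_prob q 0)"
      by (rule sum_mono) (rule max_prob_le)
    finally show ?thesis by simp
  qed
  have "(\<lambda>q. real (Suc K) * max_prob q 0) \<longlonglongrightarrow> real (Suc K) * 0"
    by (intro tendsto_intros tendsto_max_prob_0)
  then have "C.prob ?B \<le> 0"
    using le by (intro LIMSEQ_le_const[of "\<lambda>q. real (Suc K) * max_prob q 0"]) (simp_all only: mult_zero_right, blast)
  then have "C.prob ?B = 0"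
    using measure_nonneg[of coin_tosses ?B] by linarith
  then have "AE \<epsilon> in coin_tosses. \<epsilon> \<notin> ?B"
    by (simp only: C.prob_eq_0[OF B])
  then show "AE \<epsilon> in coin_tosses. \<exists>k. int K < \<sigma> * walk_path \<epsilon> k"
    by simp
qed

lemma abs_walk_path_step: "\<bar>walk_path \<epsilon> (Suc k) - walk_path \<epsilon> k\<bar> \<le> 1"
  by (simp add: walk_path_def)

text \<open>Unit steps cannot skip 0. The intermediate value theorem used is for rises, so a descent
  is handled through the negated walk.\<close>

lemma walk_path_hits_0:
  assumes "walk_path \<epsilon> m \<le> 0 \<and> 0 \<le> walk_path \<epsilon> n \<or> 0 \<le> walk_path \<epsilon> m \<and> walk_path \<epsilon> n \<le> 0" "m \<le> n"
  shows "\<exists>k. m \<le> k \<and> k \<le> n \<and> walk_path \<epsilon> k = 0"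
  using assms(1)
proof
  assume "walk_path \<epsilon> m \<le> 0 \<and> 0 \<le> walk_path \<epsilon> n"
  then show ?thesis
    using nat_intermed_int_val[of m n "walk_path \<epsilon>" 0] abs_walk_path_step assms(2) by auto
next
  assume *: "0 \<le> walk_path \<epsilon> m \<and> walk_path \<epsilon> n \<le> 0"
  have "\<bar>- walk_path \<epsilon> (Suc k) - - walk_path \<epsilon> k\<bar> \<le> 1" for k
    using abs_walk_path_step[of \<epsilon> k] by linarith
  with * show ?thesis
    using nat_intermed_int_val[of m n "\<lambda>k. - walk_path \<epsilon> k" 0] assms(2) by auto
qed

lemma AE_walk_recurrent: "AE \<epsilon> in coin_tosses. \<forall>p. \<exists>k\<ge>p. walk_path \<epsilon> k = 0"
proof -
  have "AE \<epsilon> in coin_tosses. \<forall>K. \<exists>k. int K < walk_path \<epsilon> k"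
    using AE_walk_unbounded[of 1] by simp
  moreover have "AE \<epsilon> in coin_tosses. \<forall>K. \<exists>k. int K < - walk_path \<epsilon> k"
    using AE_walk_unbounded[of "-1"] by simp
  ultimately show ?thesis
  proof eventually_elim
    case (elim \<epsilon>)
    show ?case
    proof
      fix p
      obtain k l where k: "int p < walk_path \<epsilon> k" and l: "int p < - walk_path \<epsilon> l"
        using elim by meson
      \<comment> \<open>A walk needs more than \<open>p\<close> steps to get further than
        \<open>p\<close> from 0; a zero between the two times is therefore later than
        \<open>p\<close>.\<close>
      have "p < k" "p < l"
        using k l abs_walk_path_le[of \<epsilon> k] abs_walk_path_le[of \<epsilon> l] by linarith+
      moreover have "0 \<le> walk_path \<epsilon> k" "walk_path \<epsilon> l \<le> 0"
        using k l by linarith+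
      ultimately obtain i where "min k l \<le> i" "walk_path \<epsilon> i = 0"
        using walk_path_hits_0[of \<epsilon> "min k l" "max k l"] by (cases "k \<le> l"; auto simp: min_def max_def)
      then show "\<exists>i\<ge>p. walk_path \<epsilon> i = 0"
        using \<open>p < k\<close> \<open>p < l\<close> by (intro exI[of _ i]) simp
    qed
  qed
qed

lemma next_zero_hits:
  assumes "\<exists>k\<ge>p. \<omega> k = 0"
  shows "p \<le> next_zero p \<omega>" "\<omega> (next_zero p \<omega>) = 0"
  using Inf_nat_def1[of "{k. p \<le> k \<and> \<omega> k = 0}"] assms by (auto simp: next_zero_def)

lemma next_zero_le: "p \<le> k \<Longrightarrow> \<omega> k = 0 \<Longrightarrow> next_zero p \<omega> \<le> k"
  unfolding next_zero_def by (rule cInf_lower) auto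

text \<open>From a nonpositive position the walk cannot become positive without visiting 0 first,
  and the maximum is already nonnegative, so it does not change before the next zero.\<close>

lemma running_max_next_zero:
  assumes zero: "\<exists>k\<ge>p. walk_path \<epsilon> k = 0" and "walk_path \<epsilon> p \<le> 0"
  shows "running_max (next_zero p (walk_path \<epsilon>)) (walk_path \<epsilon>) = running_max p (walk_path \<epsilon>)"
proof (rule antisym)
  let ?d = "next_zero p (walk_path \<epsilon>)"
  show "running_max ?d (walk_path \<epsilon>) \<le> running_max p (walk_path \<epsilon>)"
  proof (rule running_max_le)
    fix k assume k: "k \<le> ?d"
    show "walk_path \<epsilon> k \<le> running_max p (walk_path \<epsilon>)"
    proof (cases "k \<le> p")
      case False
      have "walk_path \<epsilon> k \<le> 0"
      proof (rule ccontr)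
        assume pos: "\<not> walk_path \<epsilon> k \<le> 0"
        then obtain i where i: "p \<le> i" "i \<le> k" "walk_path \<epsilon> i = 0"
          using walk_path_hits_0[of \<epsilon> p k] assms(2) False by auto
        then have "i = k" using next_zero_le[of p i "walk_path \<epsilon>"] k by simp
        with pos i show False by simp
      qed
      then show ?thesis using running_max_walk_bounds(1)[of p \<epsilon>] by linarith
    qed (rule running_max_ge)
  qed
  show "running_max p (walk_path \<epsilon>) \<le> running_max ?d (walk_path \<epsilon>)"
    by (rule running_max_mono[OF next_zero_hits(1)[OF zero]])
qed

subsection \<open>Penalisation\<close>

text \<open>Summation by parts reduces the partial sums to first-moment sums. The boundary term
  \<open>N * tail \<phi> N\<close> is at most the sum of \<open>k * \<phi> k\<close> over
  \<open>k \<ge> N\<close>.\<close>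

lemma summable_tail:
  assumes nonneg: "\<And>k. 0 \<le> \<phi> k" and total_mass: "\<phi> sums 1"
    and first_moment: "summable (\<lambda>k. real k * \<phi> k)"
  shows "summable (tail \<phi>)"
proof (rule bounded_imp_summable)
  have summable: "summable \<phi>" using total_mass by (rule sums_summable)
  show "0 \<le> tail \<phi> k" for k by (rule tail_nonneg[OF nonneg total_mass])
  have parts: "(\<Sum>x<N. tail \<phi> x) = real N * tail \<phi> N + (\<Sum>k<N. real (Suc k) * \<phi> k)" for N
  proof (induction N)
    case (Suc N)
    then show ?case using tail_Suc[OF nonneg total_mass, of N] by (simp add: algebra_simps)
  qed simp
  have "real N * tail \<phi> N \<le> (\<Sum>k. real k * \<phi> k)" for N
  proof -
    have sN: "summable (\<lambda>j. real (j + N) * \<phi> (j + N))"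
      using first_moment by (subst summable_iff_shift)
    have "real N * tail \<phi> N = (\<Sum>j. real N * \<phi> (j + N))"
      unfolding tail_def
      using suminf_mult[OF summable_ignore_initial_segment[OF summable, of N]] by (simp add: add.commute)
    also have "\<dots> \<le> (\<Sum>j. real (j + N) * \<phi> (j + N))"
      using nonneg by (intro suminf_le sN summable_mult summable_ignore_initial_segment summable mult_right_mono) auto
    also have "\<dots> \<le> (\<Sum>k. real k * \<phi> k)"
      using suminf_split_initial_segment[OF first_moment, of N] nonneg by (simp add: sum_nonneg)
    finally show ?thesis .
  qed
  moreover have "(\<Sum>k<N. real (Suc k) * \<phi> k) \<le> (\<Sum>k. real (Suc k) * \<phi> k)" for N
    using nonneg summable first_moment
    by (intro sum_le_suminf) (auto simp: ring_distribs intro: summable_add)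
  ultimately have bound: "(\<Sum>x<N. tail \<phi> x) \<le> (\<Sum>k. real k * \<phi> k) + (\<Sum>k. real (Suc k) * \<phi> k)" for N
    unfolding parts by (intro add_mono)
  show "(\<Sum>x\<le>N. tail \<phi> x) \<le> (\<Sum>k. real k * \<phi> k) + (\<Sum>k. real (Suc k) * \<phi> k)" for N
    using bound[of "Suc N"] by (simp add: lessThan_Suc_atMost)
qed

lemma f_pen_nonpos: "a \<le> 0 \<Longrightarrow> f_pen \<phi> b a = \<phi> b"
  by (simp add: f_pen_def)

text \<open>With \<open>r = a / b\<close> in the unit interval, \<open>f_pen\<close> is the convex
  combination with weights \<open>1 - r\<close> and \<open>r\<close> of \<open>\<phi> b\<close> and
  \<open>b\<close> times the series. As \<open>k * (k + 1) \<ge> b\<close> for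
  \<open>k \<ge> b\<close>, both are at most the tail.\<close>

lemma f_pen_bounds:
  assumes nonneg: "\<And>k. 0 \<le> \<phi> k" and total_mass: "\<phi> sums 1" and a: "0 < a" "a \<le> int b"
  shows "0 \<le> f_pen \<phi> b a" "f_pen \<phi> b a \<le> tail \<phi> b"
proof -
  have summable: "summable (\<lambda>j. \<phi> (b + j))"
    using summable_ignore_initial_segment[OF sums_summable[OF total_mass], of b] by (simp add: add.commute)
  have b: "0 < real b" using a by simp
  define r where "r = real_of_int a / real b"
  have r: "0 \<le> r" "r \<le> 1" "real_of_int a = r * real b"
    using a b by (auto simp: r_def)
  let ?u = "\<lambda>j. \<phi> (b + j) / (real (b + j) * (real (b + j) + 1))"
  have u: "0 \<le> ?u j" "?u j \<le> \<phi> (b + j) / real b" for j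
  proof -
    have "real b * 1 \<le> real (b + j) * (real (b + j) + 1)"
      using b by (intro mult_mono) auto
    then show "?u j \<le> \<phi> (b + j) / real b"
      using b nonneg by (intro divide_left_mono mult_pos_pos) auto
  qed (simp add: nonneg)
  have su: "summable ?u"
    using u by (intro summable_comparison_test'[OF summable_divide[OF summable, of "real b"], of 0])
      (simp only: real_norm_def abs_of_nonneg)
  have f: "f_pen \<phi> b a = \<phi> b * (1 - r) + of_int a * (\<Sum>j. ?u j)"
    using a by (auto simp: f_pen_def r_def)
  show "0 \<le> f_pen \<phi> b a"
    unfolding f using r nonneg a by (intro add_nonneg_nonneg mult_nonneg_nonneg suminf_nonneg su u) auto
  have "(\<Sum>j. ?u j) \<le> (\<Sum>j. \<phi> (b + j) / real b)"
    by (intro suminf_le u su summable_divide summable)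
  also have "\<dots> = tail \<phi> b / real b"
    unfolding tail_def by (rule suminf_divide[OF summable])
  finally have "of_int a * (\<Sum>j. ?u j) \<le> of_int a * (tail \<phi> b / real b)"
    using a by (intro mult_left_mono) auto
  also have "\<dots> = r * tail \<phi> b"
    using b by (simp add: r_def)
  finally have "of_int a * (\<Sum>j. ?u j) \<le> r * tail \<phi> b" .
  moreover have "\<phi> b * (1 - r) \<le> tail \<phi> b * (1 - r)"
    using r le_tail[OF nonneg total_mass, of b b] by (intro mult_right_mono) auto
  ultimately show "f_pen \<phi> b a \<le> tail \<phi> b"
    unfolding f by (simp add: algebra_simps)
qed

text \<open>Replacing \<open>Y p\<close> by \<phi> at the maximum costs at most the expected tail
  weight on positive endpoints, which \<open>tendsto_weighted_end_pos\<close> with weight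
  \<open>tail \<phi>\<close> makes negligible against \<open>max_prob p 0\<close>.\<close>

lemma tendsto_event_perturbed:
  assumes nonneg: "\<And>k. 0 \<le> \<phi> k" and total_mass: "\<phi> sums 1"
    and first_moment: "summable (\<lambda>k. real k * \<phi> k)" and event: "\<Lambda> \<in> \<F> n"
    and meas: "\<And>p. Y p \<in> borel_measurable path_algebra"
    and close: "\<And>p. AE \<epsilon> in coin_tosses. \<bar>Y p (walk_path \<epsilon>) - \<phi> (nat (running_max p (walk_path \<epsilon>)))\<bar>
      \<le> tail \<phi> (nat (running_max p (walk_path \<epsilon>))) * indicator {0<..} (walk_path \<epsilon> p)"
  shows "(\<lambda>p. (\<integral>\<omega>. indicator \<Lambda> \<omega> * Y p \<omega> \<partial>srw) / max_prob p 0)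
    \<longlonglongrightarrow> (\<integral>\<omega>. indicator \<Lambda> \<omega> * M_pen \<phi> n \<omega> \<partial>srw)"
proof -
  interpret C: prob_space coin_tosses by (rule prob_space_coin_tosses)
  let ?S = "\<lambda>p \<epsilon>. nat (running_max p (walk_path \<epsilon>))"
  let ?I = "\<lambda>\<epsilon>. indicator \<Lambda> (walk_path \<epsilon>) :: real"
  let ?T = "\<lambda>p \<epsilon>. tail \<phi> (?S p \<epsilon>) * indicator {0<..} (walk_path \<epsilon> p)"
  note tail = tail_nonneg[OF nonneg total_mass] tail_le_1[OF nonneg total_mass]
  have \<phi>_le_1: "\<phi> k \<le> 1" for k
    using le_tail[OF nonneg total_mass, of 0 k] by (simp add: tail_0[OF nonneg total_mass])
  have \<Lambda>: "\<Lambda> \<in> sets path_algebra"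
    using event filtration_subset by auto
  have I_meas: "?I \<in> borel_measurable coin_tosses"
    by (rule measurable_compose[OF walk_path_measurable borel_measurable_indicator[OF \<Lambda>]])
  have S_meas: "(\<lambda>\<epsilon>. h (?S p \<epsilon>)) \<in> borel_measurable coin_tosses" for h :: "nat \<Rightarrow> real" and p
    by (rule measurable_compose[OF measurable_running_max[OF measurable_walk]]) simp
  have X_meas: "(\<lambda>\<epsilon>. indicator {0<..} (walk_path \<epsilon> p) :: real) \<in> borel_measurable coin_tosses" for p
    by (rule measurable_compose[OF measurable_walk]) simp
  have Y_meas: "(\<lambda>\<epsilon>. Y p (walk_path \<epsilon>)) \<in> borel_measurable coin_tosses" for p
    by (rule measurable_compose[OF walk_path_measurable meas])
  have int_\<phi>: "integrable coin_tosses (\<lambda>\<epsilon>. ?I \<epsilon> * \<phi> (?S p \<epsilon>))" for p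
    using nonneg \<phi>_le_1
    by (intro C.integrable_const_bound[where B = 1] AE_I2 borel_measurable_times I_meas S_meas)
      (simp add: indicator_def)
  have int_T: "integrable coin_tosses (?T p)" for p
    using tail
    by (intro C.integrable_const_bound[where B = 1] AE_I2 borel_measurable_times X_meas S_meas)
      (simp add: indicator_def)
  have int_Y: "integrable coin_tosses (\<lambda>\<epsilon>. ?I \<epsilon> * Y p (walk_path \<epsilon>))" for p
  \<comment> \<open>The bound 2 is one unit for \<phi> and one for the permitted deviation.\<close>
  proof (rule C.integrable_const_bound[where B = 2])
    show "AE \<epsilon> in coin_tosses. norm (?I \<epsilon> * Y p (walk_path \<epsilon>)) \<le> 2"
      using close[of p]
    proof eventually_elim
      case (elim \<epsilon>)
      moreover have "?T p \<epsilon> \<le> 1" using tail by (simp add: indicator_def)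
      ultimately have "\<bar>Y p (walk_path \<epsilon>)\<bar> \<le> 2"
        using nonneg[of "?S p \<epsilon>"] \<phi>_le_1[of "?S p \<epsilon>"] by linarith
      then show ?case by (simp add: indicator_def)
    qed
    show "(\<lambda>\<epsilon>. ?I \<epsilon> * Y p (walk_path \<epsilon>)) \<in> borel_measurable coin_tosses"
      by (intro borel_measurable_times I_meas Y_meas)
  qed
  define N where "N p = (\<integral>\<epsilon>. ?I \<epsilon> * \<phi> (?S p \<epsilon>) \<partial>coin_tosses)" for p
  define D where "D p = (\<integral>\<epsilon>. ?I \<epsilon> * Y p (walk_path \<epsilon>) \<partial>coin_tosses) - N p" for p
  have D_le: "\<bar>D p\<bar> \<le> (\<integral>\<epsilon>. ?T p \<epsilon> \<partial>coin_tosses)" for p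
  proof -
    have "D p = (\<integral>\<epsilon>. ?I \<epsilon> * Y p (walk_path \<epsilon>) - ?I \<epsilon> * \<phi> (?S p \<epsilon>) \<partial>coin_tosses)"
      unfolding D_def N_def by (rule Bochner_Integration.integral_diff[OF int_Y int_\<phi>, symmetric])
    also have "\<bar>\<dots>\<bar> \<le> (\<integral>\<epsilon>. \<bar>?I \<epsilon> * Y p (walk_path \<epsilon>) - ?I \<epsilon> * \<phi> (?S p \<epsilon>)\<bar> \<partial>coin_tosses)"
      by (rule integral_abs_bound)
    also have "\<dots> \<le> (\<integral>\<epsilon>. ?T p \<epsilon> \<partial>coin_tosses)"
    proof (rule integral_mono_AE)
      show "AE \<epsilon> in coin_tosses. \<bar>?I \<epsilon> * Y p (walk_path \<epsilon>) - ?I \<epsilon> * \<phi> (?S p \<epsilon>)\<bar> \<le> ?T p \<epsilon>"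
        using close[of p]
      proof eventually_elim
        case (elim \<epsilon>)
        then show ?case
          using tail(1) by (cases "walk_path \<epsilon> \<in> \<Lambda>") simp_all
      qed
    qed (intro integrable_abs Bochner_Integration.integrable_diff int_Y int_\<phi> int_T)+
    finally show ?thesis .
  qed
  have "(\<lambda>p. D p / max_prob p 0) \<longlonglongrightarrow> 0"
  proof (rule Lim_null_comparison[OF _ tendsto_weighted_end_pos[OF summable_tail[OF nonneg total_mass first_moment] tail(1)]])
    show "\<forall>\<^sub>F p in sequentially. norm (D p / max_prob p 0) \<le> (\<integral>\<epsilon>. ?T p \<epsilon> \<partial>coin_tosses) / max_prob p 0"
      using D_le by (intro always_eventually allI) (simp add: divide_right_mono)
  qed
  moreover have "(\<lambda>p. N p / max_prob p 0) \<longlonglongrightarrow> (\<integral>\<omega>. indicator \<Lambda> \<omega> * M_pen \<phi> n \<omega> \<partial>srw)"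
  proof -
    have "(\<integral>\<omega>. indicator \<Lambda> \<omega> * \<phi> (nat (running_max p \<omega>)) \<partial>srw) = N p" for p
      unfolding N_def
      by (intro integral_srw borel_measurable_times borel_measurable_indicator \<Lambda>
          measurable_compose[OF measurable_running_max_path]) simp
    with tendsto_event_running_max[OF nonneg total_mass event] show ?thesis by simp
  qed
  ultimately have "(\<lambda>p. N p / max_prob p 0 + D p / max_prob p 0)
      \<longlonglongrightarrow> (\<integral>\<omega>. indicator \<Lambda> \<omega> * M_pen \<phi> n \<omega> \<partial>srw) + 0"
    by (intro tendsto_add)
  moreover have "(\<integral>\<omega>. indicator \<Lambda> \<omega> * Y p \<omega> \<partial>srw) = N p + D p" for p
    unfolding D_def using integral_srw[of "\<lambda>\<omega>. indicator \<Lambda> \<omega> * Y p \<omega>"] \<Lambda> meas by simp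
  ultimately show ?thesis
    by (simp add: add_divide_distrib)
qed

text \<open>The denominator is the numerator for the event \<open>paths\<close> at time 0, where
  \<open>M_pen\<close> equals 1 along the walk because the total mass is 1. The normaliser
  \<open>max_prob p 0\<close> cancels in the quotient.\<close>

lemma tendsto_penalised_ratio:
  assumes nonneg: "\<And>k. 0 \<le> \<phi> k" and total_mass: "\<phi> sums 1"
    and first_moment: "summable (\<lambda>k. real k * \<phi> k)" and event: "\<Lambda> \<in> \<F> n"
    and meas: "\<And>p. Y p \<in> borel_measurable path_algebra"
    and close: "\<And>p. AE \<epsilon> in coin_tosses. \<bar>Y p (walk_path \<epsilon>) - \<phi> (nat (running_max p (walk_path \<epsilon>)))\<bar>
      \<le> tail \<phi> (nat (running_max p (walk_path \<epsilon>))) * indicator {0<..} (walk_path \<epsilon> p)"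
  shows "(\<lambda>p. (\<integral>\<omega>. indicator \<Lambda> \<omega> * Y p \<omega> \<partial>srw) / (\<integral>\<omega>. Y p \<omega> \<partial>srw))
    \<longlonglongrightarrow> (\<integral>\<omega>. indicator \<Lambda> \<omega> * M_pen \<phi> n \<omega> \<partial>srw)"
proof -
  interpret C: prob_space coin_tosses by (rule prob_space_coin_tosses)
  have paths: "paths \<in> \<F> 0"
    unfolding \<F>_def by (rule sigma_sets_top)
  have drop: "(\<integral>\<omega>. indicator paths \<omega> * g \<omega> \<partial>srw) = (\<integral>\<omega>. g \<omega> \<partial>srw)" for g :: "_ \<Rightarrow> real"
    by (intro Bochner_Integration.integral_cong) auto
  have "(\<integral>\<omega>. M_pen \<phi> 0 \<omega> \<partial>srw) = (\<integral>\<epsilon>. 1 \<partial>coin_tosses)"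
    by (subst integral_srw[OF measurable_M_pen]) (simp add: M_pen_def tail_0[OF nonneg total_mass])
  then have "(\<lambda>p. (\<integral>\<omega>. Y p \<omega> \<partial>srw) / max_prob p 0) \<longlonglongrightarrow> 1"
    using tendsto_event_perturbed[OF nonneg total_mass first_moment paths meas close]
      C.prob_space by (simp add: drop)
  from tendsto_divide[OF tendsto_event_perturbed[OF nonneg total_mass first_moment event meas close] this]
  show ?thesis by (simp add: less_imp_neq[OF max_prob_0_pos, symmetric])
qed

lemma measurable_next_zero: "next_zero p \<in> measurable path_algebra (count_space UNIV)"
proof -
  have [measurable]: "Measurable.pred path_algebra (\<lambda>\<omega>. \<omega> k = 0)" for k
    by (rule measurable_compose[OF measurable_coordinate_path]) simp
  have "next_zero p = (\<lambda>\<omega>. LEAST k. p \<le> k \<and> \<omega> k = 0)"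
    by (simp add: next_zero_def Inf_nat_def fun_eq_iff)
  then show ?thesis by simp
qed

theorem theorem1p3:
  fixes \<phi> :: "nat \<Rightarrow> real" and n :: nat and \<Lambda> :: "(nat \<Rightarrow> int) set"
  assumes nonneg: "\<And>k. 0 \<le> \<phi> k"
    and total_mass: "\<phi> sums 1"
    and first_moment: "summable (\<lambda>k. real k * \<phi> k)"
    and event: "\<Lambda> \<in> \<F> n"
  shows
    "(\<lambda>p. (\<integral>\<omega>. indicator \<Lambda> \<omega> * \<phi> (nat (running_max (next_zero p \<omega>) \<omega>)) \<partial>srw)
          / (\<integral>\<omega>. \<phi> (nat (running_max (next_zero p \<omega>) \<omega>)) \<partial>srw))
       \<longlonglongrightarrow> (\<integral>\<omega>. indicator \<Lambda> \<omega> * M_pen \<phi> n \<omega> \<partial>srw)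
   \<and> (\<lambda>p. (\<integral>\<omega>. indicator \<Lambda> \<omega> * f_pen \<phi> (nat (running_max p \<omega>)) (\<omega> p) \<partial>srw)
          / (\<integral>\<omega>. f_pen \<phi> (nat (running_max p \<omega>)) (\<omega> p) \<partial>srw))
       \<longlonglongrightarrow> (\<integral>\<omega>. indicator \<Lambda> \<omega> * M_pen \<phi> n \<omega> \<partial>srw)
   \<and> (\<lambda>p. (\<integral>\<omega>. indicator \<Lambda> \<omega> * \<phi> (nat (running_max p \<omega>)) \<partial>srw)
          / (\<integral>\<omega>. \<phi> (nat (running_max p \<omega>)) \<partial>srw))
       \<longlonglongrightarrow> (\<integral>\<omega>. indicator \<Lambda> \<omega> * M_pen \<phi> n \<omega> \<partial>srw)"
proof (intro conjI)
  note ratio = tendsto_penalised_ratio[OF nonneg total_mass first_moment event]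
  note tail_facts = tail_nonneg[OF nonneg total_mass] le_tail[OF nonneg total_mass]
  show "(\<lambda>p. (\<integral>\<omega>. indicator \<Lambda> \<omega> * \<phi> (nat (running_max (next_zero p \<omega>) \<omega>)) \<partial>srw)
          / (\<integral>\<omega>. \<phi> (nat (running_max (next_zero p \<omega>) \<omega>)) \<partial>srw))
       \<longlonglongrightarrow> (\<integral>\<omega>. indicator \<Lambda> \<omega> * M_pen \<phi> n \<omega> \<partial>srw)"
  proof (rule ratio)
    fix p
    have "(\<lambda>\<omega>. \<phi> (nat (running_max i \<omega>))) \<in> borel_measurable path_algebra" for i
      by (rule measurable_compose[OF measurable_running_max_path]) simp
    from measurable_compose_countable[OF this measurable_next_zero]
    show "(\<lambda>\<omega>. \<phi> (nat (running_max (next_zero p \<omega>) \<omega>))) \<in> borel_measurable path_algebra" .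
    show "AE \<epsilon> in coin_tosses. \<bar>\<phi> (nat (running_max (next_zero p (walk_path \<epsilon>)) (walk_path \<epsilon>)))
        - \<phi> (nat (running_max p (walk_path \<epsilon>)))\<bar>
      \<le> tail \<phi> (nat (running_max p (walk_path \<epsilon>))) * indicator {0<..} (walk_path \<epsilon> p)"
      \<comment> \<open>Recurrence discards the paths on which \<open>next_zero\<close> takes its
        default value.\<close>
      using AE_walk_recurrent
    proof eventually_elim
      case (elim \<epsilon>)
      let ?d = "next_zero p (walk_path \<epsilon>)"
      have zero: "\<exists>k\<ge>p. walk_path \<epsilon> k = 0" using elim by blast
      show ?case
      proof (cases "walk_path \<epsilon> p \<le> 0")
        case True
        then show ?thesis using running_max_next_zero[OF zero True] by simp
      next
        case False
        \<comment> \<open>Both values of \<phi> are taken at indices no smaller than the maximum at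
          time \<open>p\<close>, so both lie between 0 and the tail there, and so does their
          distance.\<close>
        have "\<phi> (nat (running_max ?d (walk_path \<epsilon>))) \<le> tail \<phi> (nat (running_max p (walk_path \<epsilon>)))"
          by (intro tail_facts nat_mono running_max_mono next_zero_hits zero)
        moreover have "\<phi> (nat (running_max p (walk_path \<epsilon>))) \<le> tail \<phi> (nat (running_max p (walk_path \<epsilon>)))"
          by (intro tail_facts order_refl)
        ultimately show ?thesis
          using False nonneg[of "nat (running_max ?d (walk_path \<epsilon>))"]
            nonneg[of "nat (running_max p (walk_path \<epsilon>))"] by (simp add: abs_le_iff)
      qed
    qed
  qed
  show "(\<lambda>p. (\<integral>\<omega>. indicator \<Lambda> \<omega> * f_pen \<phi> (nat (running_max p \<omega>)) (\<omega> p) \<partial>srw)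
          / (\<integral>\<omega>. f_pen \<phi> (nat (running_max p \<omega>)) (\<omega> p) \<partial>srw))
       \<longlonglongrightarrow> (\<integral>\<omega>. indicator \<Lambda> \<omega> * M_pen \<phi> n \<omega> \<partial>srw)"
  proof (rule ratio)
    fix p
    have "(\<lambda>\<omega>. f_pen \<phi> (nat i) (\<omega> p)) \<in> borel_measurable path_algebra" for i
      by (rule measurable_compose[OF measurable_coordinate_path]) simp
    from measurable_compose_countable[OF this measurable_running_max_path]
    show "(\<lambda>\<omega>. f_pen \<phi> (nat (running_max p \<omega>)) (\<omega> p)) \<in> borel_measurable path_algebra" .
    show "AE \<epsilon> in coin_tosses. \<bar>f_pen \<phi> (nat (running_max p (walk_path \<epsilon>))) (walk_path \<epsilon> p)
        - \<phi> (nat (running_max p (walk_path \<epsilon>)))\<bar>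
      \<le> tail \<phi> (nat (running_max p (walk_path \<epsilon>))) * indicator {0<..} (walk_path \<epsilon> p)"
    proof (intro AE_I2)
      fix \<epsilon>
      let ?b = "nat (running_max p (walk_path \<epsilon>))"
      show "\<bar>f_pen \<phi> ?b (walk_path \<epsilon> p) - \<phi> ?b\<bar> \<le> tail \<phi> ?b * indicator {0<..} (walk_path \<epsilon> p)"
      proof (cases "walk_path \<epsilon> p \<le> 0")
        case True
        then show ?thesis by (simp add: f_pen_nonpos)
      next
        case False
        then have "0 < walk_path \<epsilon> p" "walk_path \<epsilon> p \<le> int ?b"
          using running_max_ge[of p p "walk_path \<epsilon>"] by auto
        note f_pen_bounds[OF nonneg total_mass this]
        then show ?thesis
          using False nonneg[of ?b] tail_facts(2)[of ?b ?b] by (simp add: abs_le_iff)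
      qed
    qed
  qed
  show "(\<lambda>p. (\<integral>\<omega>. indicator \<Lambda> \<omega> * \<phi> (nat (running_max p \<omega>)) \<partial>srw)
          / (\<integral>\<omega>. \<phi> (nat (running_max p \<omega>)) \<partial>srw))
       \<longlonglongrightarrow> (\<integral>\<omega>. indicator \<Lambda> \<omega> * M_pen \<phi> n \<omega> \<partial>srw)"
  proof (rule ratio)
    show "(\<lambda>\<omega>. \<phi> (nat (running_max p \<omega>))) \<in> borel_measurable path_algebra" for p
      by (rule measurable_compose[OF measurable_running_max_path]) simp
  \<comment> \<open>Here \<open>Y p\<close> is \<phi> at the maximum itself, so the deviation is 0
    and only nonnegativity of the tail is at stake.\<close>
  qed (use tail_facts in \<open>simp\<close>)
qed

end
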